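(* Let $d\geqslant 2$ and let $G$ be the intersection graph of $n$ balls in $\mathbb{R}^d$. For every fugacity $\lambda>0$, the mixing time of the Glauber dynamics on independent sets of $G$ satisfies $$\tau_{G,\lambda} = (2\tilde{\lambda})^{O(n^{1-\frac{1}{d}})},$$ where $\tilde{\lambda}=e^{|\ln\lambda|}$ and the constant hidden in $O(\cdot)$ depends only on $d$.
   Context: The intersection graph of a collection of subsets of $\mathbb{R}^d$ has one vertex per subset and an edge between two vertices iff the subsets intersect. For a graph $G=(V,E)$ with $n$ vertices, let $\mathcal{I}(G)$ be the set of independent sets (including $\emptyset$), $Z_G(\lambda)=\sum_{J\in\mathcal{I}(G)}\lambda^{|J|}$, and $\pi_{G,\lambda}(I)=\lambda^{|I|}/Z_G(\lambda)$ (the hard-core model). The Glauber dynamics is the Markov chain on $\mathcal{I}(G)$ which, from the current set $I$, picks $v\in V$ uniformly at random; if $v\in I$ it removes $v$ with probability $\frac{1}{\lambda+1}$; if $v\notin I$ and $I\cup\{v\}$ is independent it adds $v$ with probability $\frac{\lambda}{\lambda+1}$; otherwise it stays. Its stationary distribution is $\pi_{G,\lambda}$. The total variation distance is $\Delta(\mu,\nu)=\frac12\sum_{I}|\mu(I)-\nu(I)|$, $\mu_I^t$ is the distribution after $t$ steps started from $I$, and the mixing time $\tau_{G,\lambda}$ is the smallest $t$ with $\max_{I\in\mathcal{I}(G)}\Delta(\mu_I^t,\pi_{G,\lambda})\leqslant\frac14$. *)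

theory Defs
  imports "HOL-Probability.Probability"
begin

text \<open>A finite simple graph is given by its vertex set and its set of two-element edges.\<close>

type_synonym 'v graph = "'v set \<times> 'v set set"

definition indep_sets_of :: "'v graph \<Rightarrow> 'v set set" where
  "indep_sets_of G = {I. I \<subseteq> fst G \<and> (\<forall>u\<in>I. \<forall>v\<in>I. {u, v} \<notin> snd G)}"

text \<open>The collection is an indexed family, so that sets occurring repeatedly give
  distinct vertices.\<close>

definition intersection_graph :: "'v set \<Rightarrow> ('v \<Rightarrow> 'p set) \<Rightarrow> 'v graph" where
  "intersection_graph V S =
     (V, {{u, v} | u v. u \<in> V \<and> v \<in> V \<and> u \<noteq> v \<and> S u \<inter> S v \<noteq> {}})"

text \<open>Balls may be open or closed, but not degenerate.\<close>

definition is_ball :: "'a::metric_space set \<Rightarrow> bool" where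
  "is_ball B \<longleftrightarrow> (\<exists>c r. 0 < r \<and> (B = ball c r \<or> B = cball c r))"

definition hardcore_Z :: "'v graph \<Rightarrow> real \<Rightarrow> real" where
  "hardcore_Z G lam = (\<Sum>J\<in>indep_sets_of G. lam ^ card J)"

definition hardcore :: "'v graph \<Rightarrow> real \<Rightarrow> 'v set \<Rightarrow> real" where
  "hardcore G lam I = lam ^ card I / hardcore_Z G lam"

definition glauber_step :: "'v graph \<Rightarrow> real \<Rightarrow> 'v set \<Rightarrow> 'v set pmf" where
  "glauber_step G lam I =
     bind_pmf (pmf_of_set (fst G)) (\<lambda>v.
       if v \<in> I then
         map_pmf (\<lambda>b. if b then I - {v} else I) (bernoulli_pmf (1 / (lam + 1)))
       else if insert v I \<in> indep_sets_of G then
         map_pmf (\<lambda>b. if b then insert v I else I) (bernoulli_pmf (lam / (lam + 1)))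
       else return_pmf I)"

definition glauber_dist :: "'v graph \<Rightarrow> real \<Rightarrow> 'v set \<Rightarrow> nat \<Rightarrow> 'v set pmf" where
  "glauber_dist G lam I t =
     ((\<lambda>\<mu>. bind_pmf \<mu> (glauber_step G lam)) ^^ t) (return_pmf I)"

definition tv_dist :: "'s set \<Rightarrow> ('s \<Rightarrow> real) \<Rightarrow> ('s \<Rightarrow> real) \<Rightarrow> real" where
  "tv_dist \<Omega> \<mu> \<nu> = 1 / 2 * (\<Sum>x\<in>\<Omega>. \<bar>\<mu> x - \<nu> x\<bar>)"

text \<open>The value is \<open>\<infinity>\<close> if the chain never gets within distance 1/4 of the hard-core
  distribution, so a finite upper bound also asserts that the minimum exists.\<close>

definition mixing_time :: "'v graph \<Rightarrow> real \<Rightarrow> enat" where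
  "mixing_time G lam =
     (INF t \<in> {t. (MAX I \<in> indep_sets_of G.
         tv_dist (indep_sets_of G) (pmf (glauber_dist G lam I t)) (hardcore G lam)) \<le> 1 / 4}.
       enat t)"

end

theory Submission
  imports Defs
begin

text \<open>
  Any family of \<open>n\<close> balls has a balanced separator that is a union of cliques \<open>C\<close> with
  \<open>\<Sum>C. log 2 (1 + |C|) = O(n powr (1 - 1/d))\<close>.  To find it, take a smallest ball around one of the
  centres that contains a constant fraction of the centres, and average over about \<open>n powr (1/d)\<close>
  concentric spheres whose radii are between one and two times its radius \<open>s\<close>: the balls of radius about
  \<open>\<rho>\<close> fall into \<open>O((s / \<rho>) ^ d)\<close> grid cells, the balls of one cell form a clique, and each cell is
  met by a fraction \<open>O(\<rho> / s)\<close> of the spheres.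

  The partition function \<open>Z\<^sub>S\<close> of such a separator \<open>S\<close> is at most \<open>(2 exp |ln lam|)\<close> to the power
  \<open>O(n powr (1 - 1/d))\<close>.  Comparing \<open>f I\<close> with \<open>f (I - S)\<close> shows that removing \<open>S\<close> changes the Poincare
  constant only by a factor polynomial in \<open>Z\<^sub>S\<close> and \<open>n\<close>, and the Poincare constants of the two sides of
  the separator do not multiply.  Since the exponent decreases geometrically along the recursion, the
  Poincare constant of the whole graph is \<open>(2 exp |ln lam|)\<close> to the power \<open>O(n powr (1 - 1/d))\<close>.

  The transition operator is an average of orthogonal projections, hence its quadratic form bounds its
  squared norm, and the Poincare inequality gives exponential decay in \<open>L\<^sup>2\<close> without any spectral
  theory or laziness.
\<close>

section \<open>Poincare inequalities for the hard-core model\<close>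

text \<open>From here on \<open>E\<close> stays fixed and only the vertex set varies: independence
  tests only pairs inside the set, so \<open>(W, E)\<close> acts as the subgraph induced on
  \<open>W\<close>.\<close>

lemma indep_iff: "I \<in> indep_sets_of (W, E) \<longleftrightarrow> I \<subseteq> W \<and> (\<forall>u\<in>I. \<forall>v\<in>I. {u, v} \<notin> E)"
  by (simp add: indep_sets_of_def)

lemma finite_indep [simp]: "finite W \<Longrightarrow> finite (indep_sets_of (W, E))"
  by (rule finite_subset[of _ "Pow W"]) (auto simp: indep_iff)

lemma empty_indep [simp]: "{} \<in> indep_sets_of (W, E)"
  by (simp add: indep_iff)

lemma indep_subset: "I \<in> indep_sets_of (W, E) \<Longrightarrow> J \<subseteq> I \<Longrightarrow> J \<in> indep_sets_of (W, E)"
  by (auto simp: indep_iff)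

lemma indep_mono: "U \<subseteq> W \<Longrightarrow> indep_sets_of (U, E) \<subseteq> indep_sets_of (W, E)"
  by (fastforce simp: indep_iff)

lemma indep_finite: "finite W \<Longrightarrow> I \<in> indep_sets_of (W, E) \<Longrightarrow> finite I"
  by (auto simp: indep_iff intro: finite_subset)

text \<open>Splitting \<open>I\<close> into \<open>(I \<inter> U, I - U)\<close> embeds the
  independent sets into pairs and factorises the weight; pairs whose union is not independent only
  enlarge the right-hand side, because \<open>g\<close> is nonnegative.\<close>

lemma indep_sum_diff_le:
  fixes lam :: real
  assumes "finite W" "U \<subseteq> W" "lam > 0" "\<And>K. g K \<ge> 0"
  shows "(\<Sum>I\<in>indep_sets_of (W, E). lam ^ card I * g (I - U))
    \<le> hardcore_Z (U, E) lam * (\<Sum>K\<in>indep_sets_of (W - U, E). lam ^ card K * g K)"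
proof -
  let ?\<phi> = "\<lambda>I. (I \<inter> U, I - U)"
  let ?h = "\<lambda>(L, K). lam ^ card L * (lam ^ card K * g K)"
  have fin: "finite U" using assms finite_subset by blast
  have "(\<Sum>I\<in>indep_sets_of (W, E). lam ^ card I * g (I - U))
      = (\<Sum>I\<in>indep_sets_of (W, E). ?h (?\<phi> I))"
  proof (rule sum.cong)
    fix I assume "I \<in> indep_sets_of (W, E)"
    then have "finite I" using assms indep_finite by blast
    then have "card I = card (I \<inter> U) + card (I - U)"
      by (metis card_Int_Diff)
    then show "lam ^ card I * g (I - U) = ?h (?\<phi> I)" by (simp add: power_add)
  qed simp
  also have "\<dots> = (\<Sum>x\<in>?\<phi> ` indep_sets_of (W, E). ?h x)"
    by (rule sum.reindex_cong[symmetric, where l = ?\<phi>]) (auto intro!: inj_onI)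
  also have "\<dots> \<le> (\<Sum>x\<in>indep_sets_of (U, E) \<times> indep_sets_of (W - U, E). ?h x)"
    using assms fin by (intro sum_mono2) (auto simp: indep_iff)
  also have "\<dots> = hardcore_Z (U, E) lam * (\<Sum>K\<in>indep_sets_of (W - U, E). lam ^ card K * g K)"
    by (simp add: hardcore_Z_def sum_product sum.cartesian_product)
  finally show ?thesis .
qed

lemma hardcore_Z_mono:
  assumes "finite W" "U \<subseteq> W" "lam > 0"
  shows "hardcore_Z (U, E) lam \<le> hardcore_Z (W, E) lam"
  unfolding hardcore_Z_def using assms by (intro sum_mono2 indep_mono) auto

lemma hardcore_Z_ge_1:
  fixes W :: "'v set"
  assumes "finite W" "lam > 0"
  shows "hardcore_Z (W, E) lam \<ge> 1"
proof -
  have "(\<Sum>J\<in>{{} :: 'v set}. lam ^ card J) \<le> hardcore_Z (W, E) lam"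
    unfolding hardcore_Z_def using assms by (intro sum_mono2) auto
  then show ?thesis by simp
qed

lemma hardcore_Z_Un_le:
  assumes "finite W" "finite U" "lam > 0"
  shows "hardcore_Z (W \<union> U, E) lam \<le> hardcore_Z (U, E) lam * hardcore_Z (W, E) lam"
proof -
  have "hardcore_Z (W \<union> U, E) lam \<le> hardcore_Z (U, E) lam * hardcore_Z (W \<union> U - U, E) lam"
    using indep_sum_diff_le[of "W \<union> U" U lam "\<lambda>_. 1" E] assms by (simp add: hardcore_Z_def)
  also have "\<dots> \<le> hardcore_Z (U, E) lam * hardcore_Z (W, E) lam"
    using assms hardcore_Z_ge_1[of U lam E] by (intro mult_left_mono hardcore_Z_mono) auto
  finally show ?thesis .
qed

lemma hardcore_Z_Union_le:
  assumes "finite F" "\<And>C. C \<in> F \<Longrightarrow> finite C" "lam > 0"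
  shows "hardcore_Z (\<Union>F, E) lam \<le> (\<Prod>C\<in>F. hardcore_Z (C, E) lam)"
  using assms
proof (induction F rule: finite_induct)
  case empty
  have "indep_sets_of ({}, E) = {{}}" by (auto simp: indep_iff)
  then show ?case by (simp add: hardcore_Z_def)
next
  case (insert C F)
  have "hardcore_Z (\<Union>(insert C F), E) lam \<le> hardcore_Z (C, E) lam * hardcore_Z (\<Union>F, E) lam"
    using hardcore_Z_Un_le[of "\<Union>F" C lam E] insert by (simp add: Un_commute)
  also have "\<dots> \<le> hardcore_Z (C, E) lam * (\<Prod>C\<in>F. hardcore_Z (C, E) lam)"
    using insert hardcore_Z_ge_1[of C lam E] by (intro mult_left_mono) auto
  finally show ?case using insert by simp
qed

text \<open>An independent subset of a clique is empty or a single vertex.\<close>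

lemma hardcore_Z_clique_le:
  assumes "finite C" "lam > 0" "\<And>u v. u \<in> C \<Longrightarrow> v \<in> C \<Longrightarrow> u \<noteq> v \<Longrightarrow> {u, v} \<in> E"
  shows "hardcore_Z (C, E) lam \<le> 1 + lam * card C"
proof -
  have "indep_sets_of (C, E) \<subseteq> insert {} ((\<lambda>v. {v}) ` C)"
    using assms(3) by (auto simp: indep_iff) blast
  then have "hardcore_Z (C, E) lam \<le> (\<Sum>J\<in>insert {} ((\<lambda>v. {v}) ` C). lam ^ card J)"
    unfolding hardcore_Z_def using assms by (intro sum_mono2) auto
  also have "\<dots> = 1 + (\<Sum>J\<in>(\<lambda>v. {v}) ` C. lam ^ card J)"
    using assms by (subst sum.insert) auto
  also have "(\<Sum>J\<in>(\<lambda>v. {v}) ` C. lam ^ card J) = (\<Sum>v\<in>C. lam)"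
    by (subst sum.reindex) (auto simp: inj_on_def)
  finally show ?thesis by (simp add: mult.commute)
qed

lemma hardcore_Z_le_power:
  assumes "finite W" "lam > 0"
  shows "hardcore_Z (W, E) lam \<le> (1 + lam) ^ card W"
proof -
  \<comment> \<open>Each vertex is regarded as a clique of size one.\<close>
  have "hardcore_Z (\<Union>((\<lambda>v. {v}) ` W), E) lam \<le> (\<Prod>C\<in>(\<lambda>v. {v}) ` W. hardcore_Z (C, E) lam)"
    using assms by (intro hardcore_Z_Union_le) auto
  also have "\<dots> = (\<Prod>v\<in>W. hardcore_Z ({v}, E) lam)"
    by (subst prod.reindex) (auto simp: inj_on_def)
  also have "\<dots> \<le> (\<Prod>v\<in>W. 1 + lam)"
  proof (intro prod_mono conjI)
    fix v show "hardcore_Z ({v}, E) lam \<le> 1 + lam"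
      using hardcore_Z_clique_le[of "{v}" lam E] assms by simp
    show "0 \<le> hardcore_Z ({v}, E) lam"
      using hardcore_Z_ge_1[of "{v}" lam E] assms by simp
  qed
  finally show ?thesis by simp
qed

section \<open>Energy, variance and the removal of a separator\<close>

text \<open>Neither the energy nor the variance is normalised by the partition function.\<close>

definition energy :: "'v set set \<Rightarrow> real \<Rightarrow> 'v set \<Rightarrow> ('v set \<Rightarrow> real) \<Rightarrow> real" where
  "energy E lam W f =
     (\<Sum>v\<in>W. \<Sum>K | K \<in> indep_sets_of (W, E) \<and> v \<in> K. lam ^ card K * (f K - f (K - {v}))\<^sup>2)"

text \<open>Summing over ordered pairs gives \<open>2 * Z ^ 2\<close> times the variance under the
  hard-core distribution, \<open>Z\<close> being the partition function of \<open>W\<close>.\<close>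

definition dvar :: "'v set set \<Rightarrow> real \<Rightarrow> 'v set \<Rightarrow> ('v set \<Rightarrow> real) \<Rightarrow> real" where
  "dvar E lam W f = (\<Sum>I\<in>indep_sets_of (W, E). lam ^ card I *
     (\<Sum>J\<in>indep_sets_of (W, E). lam ^ card J * (f I - f J)\<^sup>2))"

text \<open>The factor \<open>hardcore_Z\<close> balances a left side quadratic in the weights
  against an energy linear in them; for the normalised quantities the constant is
  \<open>T / 2\<close>.\<close>

definition poincare :: "'v set set \<Rightarrow> real \<Rightarrow> 'v set \<Rightarrow> real \<Rightarrow> bool" where
  "poincare E lam W T \<longleftrightarrow> (\<forall>f. dvar E lam W f \<le> T * hardcore_Z (W, E) lam * energy E lam W f)"

lemma energy_nonneg: "lam > 0 \<Longrightarrow> energy E lam W f \<ge> 0"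
  unfolding energy_def by (intro sum_nonneg) auto

lemma energy_mono:
  assumes "finite W" "U \<subseteq> W" "lam > 0"
  shows "energy E lam U f \<le> energy E lam W f"
proof -
  have "energy E lam U f \<le>
    (\<Sum>v\<in>U. \<Sum>K | K \<in> indep_sets_of (W, E) \<and> v \<in> K. lam ^ card K * (f K - f (K - {v}))\<^sup>2)"
    unfolding energy_def using assms indep_mono[of U W E] by (intro sum_mono sum_mono2) auto
  also have "\<dots> \<le> energy E lam W f"
    unfolding energy_def using assms by (intro sum_mono2) (auto intro!: sum_nonneg)
  finally show ?thesis .
qed

lemma poincare_mono:
  assumes "poincare E lam W T" "T \<le> T'" "finite W" "lam > 0"
  shows "poincare E lam W T'"
  unfolding poincare_def
proof
  fix f
  have "dvar E lam W f \<le> T * hardcore_Z (W, E) lam * energy E lam W f"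
    using assms(1) by (simp add: poincare_def)
  also have "\<dots> \<le> T' * hardcore_Z (W, E) lam * energy E lam W f"
    using assms energy_nonneg[of lam E W f] hardcore_Z_ge_1[of W lam E]
    by (intro mult_right_mono) auto
  finally show "dvar E lam W f \<le> T' * hardcore_Z (W, E) lam * energy E lam W f" .
qed

lemma poincare_empty: "poincare E lam {} 0"
proof -
  have "indep_sets_of ({}, E) = {{}}" by (auto simp: indep_iff)
  then show ?thesis by (simp add: poincare_def dvar_def)
qed

text \<open>The linear order fixes the order of removal: \<open>I - {u\<in>S. u < v}\<close> is the
  state just before the turn of \<open>v\<close>. The induction adds a new maximum, which is removed
  last.\<close>

lemma telescope_removal:
  fixes f :: "'v::linorder set \<Rightarrow> real"
  assumes "finite S"
  shows "f I - f (I - S) = (\<Sum>v\<in>S. f (I - {u\<in>S. u < v}) - f (I - {u\<in>S. u < v} - {v}))"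
  using assms
proof (induction S rule: finite_linorder_max_induct)
  case empty
  then show ?case by simp
next
  case (insert b A)
  have *: "{u \<in> insert b A. u < v} = {u \<in> A. u < v}" if "v \<in> A" for v
    using insert.hyps that by auto
  have b: "{u \<in> insert b A. u < b} = A"
    using insert.hyps by auto
  have "b \<notin> A" using insert.hyps by auto
  have "(\<Sum>v\<in>insert b A. f (I - {u\<in>insert b A. u < v}) - f (I - {u\<in>insert b A. u < v} - {v}))
     = f (I - A) - f (I - A - {b}) + (\<Sum>v\<in>A. f (I - {u\<in>A. u < v}) - f (I - {u\<in>A. u < v} - {v}))"
    unfolding sum.insert[OF insert.hyps(1) \<open>b \<notin> A\<close>] b
    by (intro arg_cong2[where f = "(+)"] sum.cong refl) (simp only: *)
  also have "\<dots> = f I - f (I - insert b A)"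
    unfolding insert.IH[symmetric] Diff_insert[of I b A] by simp
  finally show ?case by (rule sym)
qed

text \<open>The elements of \<open>S\<close> are removed one at a time. Cauchy-Schwarz over these
  steps costs \<open>card S\<close>; passing from \<open>I\<close> to the intermediate state costs
  the partition function of the part already removed, which is at most that of
  \<open>S\<close>.\<close>

lemma removal_energy_le:
  fixes f :: "'v::linorder set \<Rightarrow> real"
  assumes "finite W" "S \<subseteq> W" "lam > 0"
  shows "(\<Sum>I\<in>indep_sets_of (W, E). lam ^ card I * (f I - f (I - S))\<^sup>2)
     \<le> card S * hardcore_Z (S, E) lam * energy E lam W f"
proof -
  have finS: "finite S" using assms finite_subset by blast
  \<comment> \<open>Removing an absent vertex changes nothing, so \<open>g\<close> vanishes there;
    being a function of the intermediate state alone, it fits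
    \<open>indep_sum_diff_le\<close>.\<close>
  define g where "g = (\<lambda>v K. if v \<in> K then (f K - f (K - {v}))\<^sup>2 else 0)"
  have g0: "g v K \<ge> 0" for v K by (simp add: g_def)
  have pt: "(f I - f (I - S))\<^sup>2 \<le> card S * (\<Sum>v\<in>S. g v (I - {u\<in>S. u < v}))" for I
  proof -
    have "(f I - f (I - S))\<^sup>2 = (\<Sum>v\<in>S. 1 * (f (I - {u\<in>S. u < v}) - f (I - {u\<in>S. u < v} - {v})))\<^sup>2"
      using telescope_removal[OF finS, of f I] by simp
    also have "\<dots> \<le> (\<Sum>v\<in>S. 1\<^sup>2) * (\<Sum>v\<in>S. (f (I - {u\<in>S. u < v}) - f (I - {u\<in>S. u < v} - {v}))\<^sup>2)"
      by (rule Cauchy_Schwarz_ineq_sum)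
    also have "(\<Sum>v\<in>S. (f (I - {u\<in>S. u < v}) - f (I - {u\<in>S. u < v} - {v}))\<^sup>2)
        = (\<Sum>v\<in>S. g v (I - {u\<in>S. u < v}))"
      by (rule sum.cong) (auto simp: g_def)
    finally show ?thesis by simp
  qed
  have v: "(\<Sum>I\<in>indep_sets_of (W, E). lam ^ card I * g v (I - {u\<in>S. u < v}))
       \<le> hardcore_Z (S, E) lam *
         (\<Sum>K | K \<in> indep_sets_of (W, E) \<and> v \<in> K. lam ^ card K * (f K - f (K - {v}))\<^sup>2)" for v
  proof -
    let ?U = "{u\<in>S. u < v}"
    have "(\<Sum>I\<in>indep_sets_of (W, E). lam ^ card I * g v (I - ?U))
      \<le> hardcore_Z (?U, E) lam * (\<Sum>K\<in>indep_sets_of (W - ?U, E). lam ^ card K * g v K)"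
      using assms g0 by (intro indep_sum_diff_le) auto
    also have "\<dots> \<le> hardcore_Z (S, E) lam * (\<Sum>K\<in>indep_sets_of (W, E). lam ^ card K * g v K)"
      using assms g0 finS hardcore_Z_ge_1[of S lam E]
      by (intro mult_mono hardcore_Z_mono sum_mono2 indep_mono sum_nonneg) auto
    also have "(\<Sum>K\<in>indep_sets_of (W, E). lam ^ card K * g v K) =
       (\<Sum>K | K \<in> indep_sets_of (W, E) \<and> v \<in> K. lam ^ card K * (f K - f (K - {v}))\<^sup>2)"
      using assms(1) by (intro sum.mono_neutral_cong_right) (auto simp: g_def)
    finally show ?thesis .
  qed
  have "(\<Sum>I\<in>indep_sets_of (W, E). lam ^ card I * (f I - f (I - S))\<^sup>2)
     \<le> (\<Sum>I\<in>indep_sets_of (W, E). lam ^ card I * (card S * (\<Sum>v\<in>S. g v (I - {u\<in>S. u < v}))))"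
    using assms pt by (intro sum_mono mult_left_mono) auto
  also have "\<dots> = card S * (\<Sum>v\<in>S. \<Sum>I\<in>indep_sets_of (W, E). lam ^ card I * g v (I - {u\<in>S. u < v}))"
    by (subst sum.swap) (simp add: sum_distrib_left ac_simps)
  also have "\<dots> \<le> card S * (\<Sum>v\<in>S. hardcore_Z (S, E) lam *
         (\<Sum>K | K \<in> indep_sets_of (W, E) \<and> v \<in> K. lam ^ card K * (f K - f (K - {v}))\<^sup>2))"
    using v by (intro mult_left_mono sum_mono) auto
  also have "\<dots> \<le> card S * (\<Sum>v\<in>W. hardcore_Z (S, E) lam *
         (\<Sum>K | K \<in> indep_sets_of (W, E) \<and> v \<in> K. lam ^ card K * (f K - f (K - {v}))\<^sup>2))"
    using assms hardcore_Z_ge_1[of S lam E] finS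
    by (intro mult_left_mono sum_mono2) (auto intro!: sum_nonneg mult_nonneg_nonneg)
  also have "\<dots> = card S * hardcore_Z (S, E) lam * energy E lam W f"
    by (simp add: energy_def sum_distrib_left ac_simps)
  finally show ?thesis .
qed

text \<open>Cauchy-Schwarz for three increments, whose defect is the sum of the squares of their
  pairwise differences. The last square is written \<open>(d - c)\<close> so that both ends have the
  same form when applied to \<open>f I\<close> and \<open>f J\<close>.\<close>

lemma square_three_sum_le: "(a - d)\<^sup>2 \<le> 3 * ((a - b)\<^sup>2 + (b - c)\<^sup>2 + (d - c)\<^sup>2)" for a b c d :: real
proof -
  have "0 \<le> ((a - b) - (b - c))\<^sup>2 + ((b - c) - (c - d))\<^sup>2 + ((a - b) - (c - d))\<^sup>2" by simp
  then show ?thesis by (simp add: power2_eq_square algebra_simps)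
qed

text \<open>The pairs \<open>f I\<close>, \<open>f J\<close> are compared via \<open>f (I - S)\<close> and \<open>f (J - S)\<close>; the image of the hard-core
  measure under removal of \<open>S\<close> exceeds the hard-core measure of \<open>W - S\<close> at most by the factor
  \<open>hardcore_Z (S, E) lam\<close>.\<close>

lemma poincare_separator:
  fixes W :: "'v::linorder set"
  assumes "finite W" "S \<subseteq> W" "lam > 0" "poincare E lam (W - S) T" "T \<ge> 0"
  shows "poincare E lam W (6 * real (card W) * hardcore_Z (S, E) lam + 3 * (hardcore_Z (S, E) lam)\<^sup>2 * T)"
  unfolding poincare_def
proof
  fix f :: "'v set \<Rightarrow> real"
  let ?I = "indep_sets_of (W, E)" and ?I' = "indep_sets_of (W - S, E)"
  let ?w = "\<lambda>I :: 'v set. lam ^ card I" and ?Z = "\<lambda>W. hardcore_Z (W, E) lam"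
  have finS: "finite S" using assms finite_subset by blast
  have Z1: "?Z S \<ge> 1" "?Z W \<ge> 1"
    using hardcore_Z_ge_1[OF _ assms(3)] assms(1) finS by auto
  have e0: "energy E lam W f \<ge> 0" using energy_nonneg assms(3) by auto
  let ?X = "\<Sum>I\<in>?I. ?w I * (f I - f (I - S))\<^sup>2"
  let ?Y = "\<Sum>I\<in>?I. ?w I * (\<Sum>J\<in>?I. ?w J * (f (I - S) - f (J - S))\<^sup>2)"
  have "dvar E lam W f \<le> (\<Sum>I\<in>?I. ?w I * (\<Sum>J\<in>?I. ?w J *
      (3 * ((f I - f (I - S))\<^sup>2 + (f (I - S) - f (J - S))\<^sup>2 + (f J - f (J - S))\<^sup>2))))"
    unfolding dvar_def using assms square_three_sum_le by (intro sum_mono mult_left_mono) auto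
  also have "\<dots> = 3 * ((\<Sum>I\<in>?I. \<Sum>J\<in>?I. ?w J * (?w I * (f I - f (I - S))\<^sup>2)) + ?Y
      + (\<Sum>I\<in>?I. ?w I * (\<Sum>J\<in>?I. ?w J * (f J - f (J - S))\<^sup>2)))"
    by (simp add: sum.distrib sum_distrib_left algebra_simps)
  also have "(\<Sum>I\<in>?I. \<Sum>J\<in>?I. ?w J * (?w I * (f I - f (I - S))\<^sup>2)) = ?Z W * ?X"
    by (subst sum.swap) (simp add: hardcore_Z_def sum_product)
  also have "(\<Sum>I\<in>?I. ?w I * (\<Sum>J\<in>?I. ?w J * (f J - f (J - S))\<^sup>2)) = ?Z W * ?X"
    by (simp add: hardcore_Z_def sum_distrib_right)
  finally have 1: "dvar E lam W f \<le> 3 * (2 * ?Z W * ?X + ?Y)" by simp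
  have "?X \<le> card S * ?Z S * energy E lam W f"
    by (rule removal_energy_le[OF assms(1-3)])
  also have "\<dots> \<le> card W * ?Z S * energy E lam W f"
    using assms Z1 e0 by (intro mult_right_mono) (auto intro: card_mono)
  finally have 2: "?X \<le> card W * ?Z S * energy E lam W f" .
  \<comment> \<open>The image-measure bound is applied once to \<open>I\<close> and once to
    \<open>J\<close>, hence the square of the partition function of \<open>S\<close>.\<close>
  have "?Y \<le> ?Z S * (\<Sum>I\<in>?I'. ?w I * (\<Sum>J\<in>?I. ?w J * (f I - f (J - S))\<^sup>2))"
    using assms by (intro indep_sum_diff_le[where g = "\<lambda>I. \<Sum>J\<in>?I. ?w J * (f I - f (J - S))\<^sup>2"])
      (auto intro!: sum_nonneg)
  also have "\<dots> \<le> ?Z S * (\<Sum>I\<in>?I'. ?w I * (?Z S * (\<Sum>J\<in>?I'. ?w J * (f I - f J)\<^sup>2)))"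
    using assms Z1
    by (intro mult_left_mono sum_mono indep_sum_diff_le[where g = "\<lambda>J. (f _ - f J)\<^sup>2"]) auto
  also have "\<dots> = (?Z S)\<^sup>2 * dvar E lam (W - S) f"
    by (simp add: dvar_def sum_distrib_left power2_eq_square ac_simps)
  also have "\<dots> \<le> (?Z S)\<^sup>2 * (T * ?Z (W - S) * energy E lam (W - S) f)"
    using assms(4) by (intro mult_left_mono) (auto simp: poincare_def)
  also have "\<dots> \<le> (?Z S)\<^sup>2 * (T * ?Z W * energy E lam W f)"
    using assms Z1 energy_nonneg[of lam E "W - S" f] e0
    by (intro mult_left_mono mult_mono hardcore_Z_mono energy_mono mult_nonneg_nonneg) auto
  finally have 3: "?Y \<le> (?Z S)\<^sup>2 * (T * ?Z W * energy E lam W f)" .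
  have "3 * (2 * ?Z W * ?X + ?Y) \<le> 3 * (2 * ?Z W * (card W * ?Z S * energy E lam W f)
      + (?Z S)\<^sup>2 * (T * ?Z W * energy E lam W f))"
    using 2 3 Z1 by (intro mult_left_mono add_mono) auto
  with 1 show "dvar E lam W f \<le> (6 * real (card W) * ?Z S + 3 * (?Z S)\<^sup>2 * T) * ?Z W * energy E lam W f"
    by (simp add: algebra_simps)
qed

section \<open>Disjoint unions without edges between the two sides\<close>

text \<open>\<open>K\<close> corresponds to \<open>(K \<inter> A, K \<inter> B)\<close>; without
  edges between the sides every pair of independent sets arises.\<close>

lemma indep_sum_Un:
  assumes "finite A" "finite B" "A \<inter> B = {}"
    and "\<And>a b. a \<in> A \<Longrightarrow> b \<in> B \<Longrightarrow> {a, b} \<notin> E"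
  shows "(\<Sum>I\<in>indep_sets_of (A \<union> B, E). h I)
    = (\<Sum>I\<in>indep_sets_of (A, E). \<Sum>J\<in>indep_sets_of (B, E). h (I \<union> J))"
proof -
  let ?P = "indep_sets_of (A, E) \<times> indep_sets_of (B, E)"
  have "bij_betw (\<lambda>(I, J). I \<union> J) ?P (indep_sets_of (A \<union> B, E))"
  proof (rule bij_betw_byWitness[where f' = "\<lambda>K. (K \<inter> A, K \<inter> B)"])
    show "\<forall>a\<in>?P. (\<lambda>K. (K \<inter> A, K \<inter> B)) ((\<lambda>(I, J). I \<union> J) a) = a"
      using assms(3) by (fastforce simp: indep_iff)
    show "\<forall>a'\<in>indep_sets_of (A \<union> B, E). (\<lambda>(I, J). I \<union> J) (a' \<inter> A, a' \<inter> B) = a'"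
      by (auto simp: indep_iff)
    show "(\<lambda>(I, J). I \<union> J) ` ?P \<subseteq> indep_sets_of (A \<union> B, E)"
    proof clarsimp
      fix I J assume IJ: "I \<in> indep_sets_of (A, E)" "J \<in> indep_sets_of (B, E)"
      have "{u, v} \<notin> E" if "u \<in> I" "v \<in> J" for u v
        using assms(4)[of u v] IJ that by (auto simp: indep_iff)
      moreover from this have "{v, u} \<notin> E" if "u \<in> I" "v \<in> J" for u v
        using that by (simp add: insert_commute)
      ultimately show "I \<union> J \<in> indep_sets_of (A \<union> B, E)"
        using IJ by (auto simp: indep_iff)
    qed
    show "(\<lambda>K. (K \<inter> A, K \<inter> B)) ` indep_sets_of (A \<union> B, E) \<subseteq> ?P"
      by (auto simp: indep_iff)
  qed
  then have "(\<Sum>I\<in>indep_sets_of (A \<union> B, E). h I) = (\<Sum>(I, J)\<in>?P. h (I \<union> J))"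
    by (metis (no_types, lifting) case_prod_unfold sum.cong sum.reindex_bij_betw)
  then show ?thesis by (simp add: sum.cartesian_product)
qed

lemma card_Un_indep:
  assumes "finite A" "finite B" "A \<inter> B = {}" "I \<in> indep_sets_of (A, E)" "J \<in> indep_sets_of (B, E)"
  shows "card (I \<union> J) = card I + card J"
proof (rule card_Un_disjoint)
  show "finite I" "finite J" using assms indep_finite by blast+
  show "I \<inter> J = {}" using assms by (auto simp: indep_iff)
qed

lemma hardcore_Z_Un:
  assumes "finite A" "finite B" "A \<inter> B = {}"
    and "\<And>a b. a \<in> A \<Longrightarrow> b \<in> B \<Longrightarrow> {a, b} \<notin> E"
  shows "hardcore_Z (A \<union> B, E) lam = hardcore_Z (A, E) lam * hardcore_Z (B, E) lam"
proof -
  have "hardcore_Z (A \<union> B, E) lam =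
      (\<Sum>I\<in>indep_sets_of (A, E). \<Sum>J\<in>indep_sets_of (B, E). lam ^ card (I \<union> J))"
    unfolding hardcore_Z_def using assms by (rule indep_sum_Un)
  also have "\<dots> = (\<Sum>I\<in>indep_sets_of (A, E). \<Sum>J\<in>indep_sets_of (B, E). lam ^ card I * lam ^ card J)"
    using assms by (intro sum.cong refl) (simp add: card_Un_indep power_add)
  also have "\<dots> = hardcore_Z (A, E) lam * hardcore_Z (B, E) lam"
    by (simp only: hardcore_Z_def sum_product)
  finally show ?thesis .
qed

text \<open>Removing a vertex of \<open>A\<close> leaves the \<open>B\<close> part \<open>J\<close>
  alone, so these terms are the energies on \<open>A\<close> of the sections of \<open>f\<close> at
  fixed \<open>J\<close>.\<close>

lemma energy_Un_part:
  assumes "finite A" "finite B" "A \<inter> B = {}"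
    and "\<And>a b. a \<in> A \<Longrightarrow> b \<in> B \<Longrightarrow> {a, b} \<notin> E"
  shows "(\<Sum>v\<in>A. \<Sum>K | K \<in> indep_sets_of (A \<union> B, E) \<and> v \<in> K. lam ^ card K * (f K - f (K - {v}))\<^sup>2)
    = (\<Sum>J\<in>indep_sets_of (B, E). lam ^ card J * energy E lam A (\<lambda>I. f (I \<union> J)))"
proof -
  let ?A = "indep_sets_of (A, E)" and ?B = "indep_sets_of (B, E)"
  have *: "(\<Sum>K | K \<in> indep_sets_of (A \<union> B, E) \<and> v \<in> K. lam ^ card K * (f K - f (K - {v}))\<^sup>2)
    = (\<Sum>J\<in>?B. \<Sum>I | I \<in> ?A \<and> v \<in> I. lam ^ card J * (lam ^ card I * (f (I \<union> J) - f (I - {v} \<union> J))\<^sup>2))"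
    if "v \<in> A" for v
  proof -
    have "(\<Sum>K | K \<in> indep_sets_of (A \<union> B, E) \<and> v \<in> K. lam ^ card K * (f K - f (K - {v}))\<^sup>2)
      = (\<Sum>K\<in>indep_sets_of (A \<union> B, E). if v \<in> K then lam ^ card K * (f K - f (K - {v}))\<^sup>2 else 0)"
      using assms(1,2) by (intro sum.mono_neutral_cong_left) auto
    also have "\<dots> = (\<Sum>I\<in>?A. \<Sum>J\<in>?B. if v \<in> I \<union> J
         then lam ^ card (I \<union> J) * (f (I \<union> J) - f (I \<union> J - {v}))\<^sup>2 else 0)"
      using assms by (rule indep_sum_Un)
    also have "\<dots> = (\<Sum>I\<in>?A. \<Sum>J\<in>?B. if v \<in> I
         then lam ^ card J * (lam ^ card I * (f (I \<union> J) - f (I - {v} \<union> J))\<^sup>2) else 0)"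
    proof (intro sum.cong refl)
      fix I J assume IJ: "I \<in> ?A" "J \<in> ?B"
      then have "v \<notin> J" using that assms(3) by (auto simp: indep_iff)
      then have "v \<in> I \<union> J \<longleftrightarrow> v \<in> I" "I \<union> J - {v} = I - {v} \<union> J" by auto
      then show "(if v \<in> I \<union> J then lam ^ card (I \<union> J) * (f (I \<union> J) - f (I \<union> J - {v}))\<^sup>2 else 0)
        = (if v \<in> I then lam ^ card J * (lam ^ card I * (f (I \<union> J) - f (I - {v} \<union> J))\<^sup>2) else 0)"
        using IJ assms(1-3) by (simp add: card_Un_indep power_add)
    qed
    also have "\<dots> = (\<Sum>J\<in>?B. \<Sum>I\<in>?A. if v \<in> I
         then lam ^ card J * (lam ^ card I * (f (I \<union> J) - f (I - {v} \<union> J))\<^sup>2) else 0)"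
      by (rule sum.swap)
    also have "\<dots> = (\<Sum>J\<in>?B. \<Sum>I | I \<in> ?A \<and> v \<in> I. lam ^ card J * (lam ^ card I * (f (I \<union> J) - f (I - {v} \<union> J))\<^sup>2))"
      using assms(1) by (intro sum.cong refl sum.mono_neutral_cong_right) auto
    finally show ?thesis .
  qed
  have "(\<Sum>v\<in>A. \<Sum>K | K \<in> indep_sets_of (A \<union> B, E) \<and> v \<in> K. lam ^ card K * (f K - f (K - {v}))\<^sup>2)
    = (\<Sum>v\<in>A. \<Sum>J\<in>?B. \<Sum>I | I \<in> ?A \<and> v \<in> I. lam ^ card J * (lam ^ card I * (f (I \<union> J) - f (I - {v} \<union> J))\<^sup>2))"
    by (rule sum.cong[OF refl *])
  also have "\<dots> = (\<Sum>J\<in>?B. \<Sum>v\<in>A. \<Sum>I | I \<in> ?A \<and> v \<in> I. lam ^ card J * (lam ^ card I * (f (I \<union> J) - f (I - {v} \<union> J))\<^sup>2))"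
    by (rule sum.swap)
  finally show ?thesis by (simp only: energy_def sum_distrib_left)
qed

lemma energy_Un:
  assumes "finite A" "finite B" "A \<inter> B = {}"
    and nE: "\<And>a b. a \<in> A \<Longrightarrow> b \<in> B \<Longrightarrow> {a, b} \<notin> E"
  shows "energy E lam (A \<union> B) f =
    (\<Sum>J\<in>indep_sets_of (B, E). lam ^ card J * energy E lam A (\<lambda>I. f (I \<union> J)))
    + (\<Sum>I\<in>indep_sets_of (A, E). lam ^ card I * energy E lam B (\<lambda>J. f (I \<union> J)))"
proof -
  have "energy E lam (A \<union> B) f =
     (\<Sum>v\<in>A. \<Sum>K | K \<in> indep_sets_of (A \<union> B, E) \<and> v \<in> K. lam ^ card K * (f K - f (K - {v}))\<^sup>2)
     + (\<Sum>v\<in>B. \<Sum>K | K \<in> indep_sets_of (B \<union> A, E) \<and> v \<in> K. lam ^ card K * (f K - f (K - {v}))\<^sup>2)"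
    unfolding energy_def using assms by (subst sum.union_disjoint) (auto simp: Un_commute)
  also have "(\<Sum>v\<in>A. \<Sum>K | K \<in> indep_sets_of (A \<union> B, E) \<and> v \<in> K. lam ^ card K * (f K - f (K - {v}))\<^sup>2)
    = (\<Sum>J\<in>indep_sets_of (B, E). lam ^ card J * energy E lam A (\<lambda>I. f (I \<union> J)))"
    by (rule energy_Un_part[OF assms])
  also have "(\<Sum>v\<in>B. \<Sum>K | K \<in> indep_sets_of (B \<union> A, E) \<and> v \<in> K. lam ^ card K * (f K - f (K - {v}))\<^sup>2)
    = (\<Sum>I\<in>indep_sets_of (A, E). lam ^ card I * energy E lam B (\<lambda>J. f (J \<union> I)))"
  proof (rule energy_Un_part)
    show "{b, a} \<notin> E" if "b \<in> B" "a \<in> A" for a b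
      using nE[OF that(2,1)] by (simp add: insert_commute)
  qed (use assms in auto)
  finally show ?thesis by (simp only: Un_commute[of _ "_ :: 'a set"])
qed

lemma square_two_sum_le: "(a - c)\<^sup>2 \<le> 2 * ((a - b)\<^sup>2 + (b - c)\<^sup>2)" for a b c :: real
proof -
  have "0 \<le> ((a - b) - (b - c))\<^sup>2" by simp
  then show ?thesis by (simp add: power2_eq_square algebra_simps)
qed

text \<open>The two sides are changed one after the other, so their constants are not multiplied.
  The factor 2 comes from \<open>square_two_sum_le\<close> and is absorbed by the recursion.\<close>

lemma poincare_Un:
  assumes "finite A" "finite B" "A \<inter> B = {}" "lam > 0"
    and nE: "\<And>a b. a \<in> A \<Longrightarrow> b \<in> B \<Longrightarrow> {a, b} \<notin> E"
    and pA: "poincare E lam A T" and pB: "poincare E lam B T"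
  shows "poincare E lam (A \<union> B) (2 * T)"
  unfolding poincare_def
proof
  fix f :: "'a set \<Rightarrow> real"
  let ?A = "indep_sets_of (A, E)" and ?B = "indep_sets_of (B, E)"
  let ?w = "\<lambda>I :: 'a set. lam ^ card I" and ?Z = "\<lambda>W. hardcore_Z (W, E) lam"
  have Z0: "?Z A \<ge> 0" "?Z B \<ge> 0"
    using hardcore_Z_ge_1[of A lam E] hardcore_Z_ge_1[of B lam E] assms by auto
  have "dvar E lam (A \<union> B) f = (\<Sum>I\<in>?A. \<Sum>J\<in>?B. ?w (I \<union> J) *
      (\<Sum>I'\<in>?A. \<Sum>J'\<in>?B. ?w (I' \<union> J') * (f (I \<union> J) - f (I' \<union> J'))\<^sup>2))"
    unfolding dvar_def by (simp only: indep_sum_Un[OF assms(1-3) nE])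
  also have "\<dots> = (\<Sum>I\<in>?A. \<Sum>J\<in>?B. ?w I * ?w J *
      (\<Sum>I'\<in>?A. \<Sum>J'\<in>?B. ?w I' * ?w J' * (f (I \<union> J) - f (I' \<union> J'))\<^sup>2))"
    using assms(1-3) by (intro sum.cong refl arg_cong2[where f = "(*)"]) (auto simp: card_Un_indep power_add)
  \<comment> \<open>The intermediate state is \<open>I' \<union> J\<close>: first the
    \<open>A\<close> part is replaced, then the \<open>B\<close> part.\<close>
  also have "\<dots> \<le> (\<Sum>I\<in>?A. \<Sum>J\<in>?B. ?w I * ?w J *
      (\<Sum>I'\<in>?A. \<Sum>J'\<in>?B. ?w I' * ?w J' * (2 * ((f (I \<union> J) - f (I' \<union> J))\<^sup>2 + (f (I' \<union> J) - f (I' \<union> J'))\<^sup>2))))"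
    using assms square_two_sum_le by (intro sum_mono mult_left_mono) auto
  \<comment> \<open>The variable missing from the square, \<open>J'\<close> in the first sum and
    \<open>I\<close> in the second, stands outermost and will sum to a partition function.\<close>
  also have "\<dots> = 2 * (\<Sum>I\<in>?A. \<Sum>J\<in>?B. \<Sum>I'\<in>?A. \<Sum>J'\<in>?B.
       ?w J' * (?w J * (?w I * (?w I' * (f (I \<union> J) - f (I' \<union> J))\<^sup>2))))
     + 2 * (\<Sum>I\<in>?A. \<Sum>J\<in>?B. \<Sum>I'\<in>?A. \<Sum>J'\<in>?B.
       ?w I * (?w I' * (?w J * (?w J' * (f (I' \<union> J) - f (I' \<union> J'))\<^sup>2))))"
    by (simp add: sum_distrib_left sum.distrib[symmetric] algebra_simps)
  also have "(\<Sum>I\<in>?A. \<Sum>J\<in>?B. \<Sum>I'\<in>?A. \<Sum>J'\<in>?B.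
       ?w J' * (?w J * (?w I * (?w I' * (f (I \<union> J) - f (I' \<union> J))\<^sup>2))))
     = ?Z B * (\<Sum>J\<in>?B. ?w J * dvar E lam A (\<lambda>I. f (I \<union> J)))"
  proof -
    have "(\<Sum>I\<in>?A. \<Sum>J\<in>?B. \<Sum>I'\<in>?A. \<Sum>J'\<in>?B.
       ?w J' * (?w J * (?w I * (?w I' * (f (I \<union> J) - f (I' \<union> J))\<^sup>2))))
     = (\<Sum>I\<in>?A. \<Sum>J\<in>?B. \<Sum>I'\<in>?A.
       ?Z B * (?w J * (?w I * (?w I' * (f (I \<union> J) - f (I' \<union> J))\<^sup>2))))"
      by (simp only: hardcore_Z_def sum_distrib_right)
    also have "\<dots> = (\<Sum>J\<in>?B. \<Sum>I\<in>?A. \<Sum>I'\<in>?A.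
       ?Z B * (?w J * (?w I * (?w I' * (f (I \<union> J) - f (I' \<union> J))\<^sup>2))))"
      by (rule sum.swap)
    finally show ?thesis by (simp only: dvar_def sum_distrib_left)
  qed
  also have "(\<Sum>I\<in>?A. \<Sum>J\<in>?B. \<Sum>I'\<in>?A. \<Sum>J'\<in>?B.
       ?w I * (?w I' * (?w J * (?w J' * (f (I' \<union> J) - f (I' \<union> J'))\<^sup>2))))
     = ?Z A * (\<Sum>I\<in>?A. ?w I * dvar E lam B (\<lambda>J. f (I \<union> J)))"
  proof -
    have "(\<Sum>J\<in>?B. \<Sum>I'\<in>?A. \<Sum>J'\<in>?B.
       ?w I * (?w I' * (?w J * (?w J' * (f (I' \<union> J) - f (I' \<union> J'))\<^sup>2))))
      = (\<Sum>I'\<in>?A. \<Sum>J\<in>?B. \<Sum>J'\<in>?B.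
       ?w I * (?w I' * (?w J * (?w J' * (f (I' \<union> J) - f (I' \<union> J'))\<^sup>2))))" for I
      by (rule sum.swap)
    then have "(\<Sum>I\<in>?A. \<Sum>J\<in>?B. \<Sum>I'\<in>?A. \<Sum>J'\<in>?B.
        ?w I * (?w I' * (?w J * (?w J' * (f (I' \<union> J) - f (I' \<union> J'))\<^sup>2))))
      = (\<Sum>I\<in>?A. \<Sum>I'\<in>?A. \<Sum>J\<in>?B. \<Sum>J'\<in>?B.
        ?w I * (?w I' * (?w J * (?w J' * (f (I' \<union> J) - f (I' \<union> J'))\<^sup>2))))"
      by (rule sum.cong[OF refl])
    also have "\<dots> = (\<Sum>I\<in>?A. \<Sum>I'\<in>?A. ?w I * (?w I' * dvar E lam B (\<lambda>J. f (I' \<union> J))))"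
      by (simp only: dvar_def sum_distrib_left)
    also have "\<dots> = ?Z A * (\<Sum>I\<in>?A. ?w I * dvar E lam B (\<lambda>J. f (I \<union> J)))"
      by (simp only: hardcore_Z_def sum_product)
    finally show ?thesis .
  qed
  also have "2 * (?Z B * (\<Sum>J\<in>?B. ?w J * dvar E lam A (\<lambda>I. f (I \<union> J))))
       + 2 * (?Z A * (\<Sum>I\<in>?A. ?w I * dvar E lam B (\<lambda>J. f (I \<union> J))))
     \<le> 2 * (?Z B * (\<Sum>J\<in>?B. ?w J * (T * ?Z A * energy E lam A (\<lambda>I. f (I \<union> J)))))
       + 2 * (?Z A * (\<Sum>I\<in>?A. ?w I * (T * ?Z B * energy E lam B (\<lambda>J. f (I \<union> J)))))"
    using pA pB Z0 assms unfolding poincare_def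
    by (intro add_mono mult_left_mono sum_mono) auto
  also have "\<dots> = 2 * T * (?Z A * ?Z B) * energy E lam (A \<union> B) f"
  proof -
    have *: "(\<Sum>J\<in>X. ?w J * (T * z * e J)) = T * z * (\<Sum>J\<in>X. ?w J * e J)" for X z e
      by (simp add: sum_distrib_left ac_simps)
    have "energy E lam (A \<union> B) f = (\<Sum>J\<in>?B. ?w J * energy E lam A (\<lambda>I. f (I \<union> J)))
       + (\<Sum>I\<in>?A. ?w I * energy E lam B (\<lambda>J. f (I \<union> J)))"
      using assms(1-3) nE by (rule energy_Un)
    then show ?thesis
      unfolding * by (simp add: algebra_simps)
  qed
  also have "?Z A * ?Z B = ?Z (A \<union> B)"
    using hardcore_Z_Un[OF assms(1-3) nE, of lam] by simp
  finally show "dvar E lam (A \<union> B) f \<le> 2 * T * ?Z (A \<union> B) * energy E lam (A \<union> B) f" .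
qed

section \<open>The separator recursion\<close>

text \<open>Polynomial factors in \<open>n\<close> are absorbed into the exponent: with
  \<open>y = sqrt n\<close> one has \<open>y \<le> 2 powr (2 * y)\<close>, which is squared, and
  \<open>y \<le> n powr \<gamma>\<close>.\<close>

lemma of_nat_le_powr:
  fixes n :: nat and L \<gamma> :: real
  assumes "n \<ge> 1" "L \<ge> 2" "\<gamma> \<ge> 1/2"
  shows "real n \<le> L powr (4 * real n powr \<gamma>)"
proof -
  define y where "y = sqrt (real n)"
  have y: "y \<ge> 0" "real n = y\<^sup>2" by (auto simp: y_def)
  have "y \<le> 2 * ln 2 * y" using y ln2_ge_two_thirds by (intro mult_le_cancel_right1[THEN iffD2]) auto
  also have "\<dots> \<le> exp (2 * ln 2 * y)" using exp_ge_add_one_self[of "2 * ln 2 * y"] by linarith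
  also have "\<dots> = 2 powr (2 * y)" by (simp add: powr_def ac_simps)
  finally have "real n \<le> (2 powr (2 * y))\<^sup>2"
    unfolding y(2) using y(1) by (intro power_mono) auto
  also have "\<dots> = 2 powr (4 * y)" by (simp add: power2_eq_square powr_add[symmetric])
  also have "\<dots> \<le> 2 powr (4 * real n powr \<gamma>)"
  proof -
    have "y = real n powr (1/2)" by (simp add: y_def powr_half_sqrt)
    also have "\<dots> \<le> real n powr \<gamma>" using assms by (intro powr_mono) auto
    finally show ?thesis by simp
  qed
  also have "\<dots> \<le> L powr (4 * real n powr \<gamma>)" using assms by (intro powr_mono2) auto
  finally show ?thesis .
qed

text \<open>The coefficient \<open>C\<close> of the exponent solves
  \<open>C = 2 * c + 8 + C * \<alpha> powr \<gamma>\<close>. Here \<open>2 * c\<close> pays for the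
  squared partition function of the separator, \<open>C * \<alpha> powr \<gamma>\<close> for the two
  parts, and 8 for the polynomial and constant factors.\<close>

lemma poincare_recursion:
  fixes V :: "'v::linorder set" and L \<gamma> \<alpha> c :: real
  assumes "finite V" "lam > 0" "L \<ge> 2" "\<gamma> \<ge> 1/2" "0 < \<alpha>" "\<alpha> < 1" "c \<ge> 0"
    and sep: "\<And>W. W \<subseteq> V \<Longrightarrow> W \<noteq> {} \<Longrightarrow> \<exists>S A B. W = S \<union> (A \<union> B) \<and> S \<inter> (A \<union> B) = {} \<and> A \<inter> B = {}
       \<and> (\<forall>a\<in>A. \<forall>b\<in>B. {a, b} \<notin> E) \<and> card A \<le> \<alpha> * card W \<and> card B \<le> \<alpha> * card W
       \<and> hardcore_Z (S, E) lam \<le> L powr (c * card W powr \<gamma>)"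
    and "W \<subseteq> V"
  shows "poincare E lam W (L powr ((2 * c + 8) / (1 - \<alpha> powr \<gamma>) * card W powr \<gamma>))"
  using \<open>W \<subseteq> V\<close>
proof (induction "card W" arbitrary: W rule: less_induct)
  case less
  define C where "C = (2 * c + 8) / (1 - \<alpha> powr \<gamma>)"
  define x where "x = card W powr \<gamma>"
  have "\<alpha> powr \<gamma> < 1" using powr_less_mono2[of \<gamma> \<alpha> 1] assms by simp
  then have C: "C \<ge> 0" "C = 2 * c + 8 + C * \<alpha> powr \<gamma>" using assms by (auto simp: C_def field_simps)
  have finW: "finite W" using less.prems assms(1) finite_subset by blast
  show ?case
  proof (cases "W = {}")
    case True
    then show ?thesis using poincare_mono[OF poincare_empty] assms(2) by auto
  next
    case False
    then obtain S A B where W: "W = S \<union> (A \<union> B)" "S \<inter> (A \<union> B) = {}" "A \<inter> B = {}"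
       "\<forall>a\<in>A. \<forall>b\<in>B. {a, b} \<notin> E" "card A \<le> \<alpha> * card W" "card B \<le> \<alpha> * card W"
       "hardcore_Z (S, E) lam \<le> L powr (c * card W powr \<gamma>)"
      using sep[OF less.prems] by blast
    have n1: "card W \<ge> 1" using False finW by (simp add: Suc_leI card_gt_0_iff)
    then have x1: "x \<ge> 1" unfolding x_def using assms by (intro ge_one_powr_ge_zero) auto
    have fin: "finite S" "finite A" "finite B" using finW W(1) by auto
    let ?T = "L powr (C * \<alpha> powr \<gamma> * x)"
    have part: "poincare E lam X ?T" if "X \<subseteq> W" "card X \<le> \<alpha> * card W" for X
    proof -
      have "\<alpha> * card W < 1 * real (card W)" using n1 assms by (intro mult_strict_right_mono) auto
      then have "card X < card W" using that by simp
      then have p: "poincare E lam X (L powr (C * card X powr \<gamma>))"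
        using less that unfolding C_def by blast
      have "card X powr \<gamma> \<le> (\<alpha> * card W) powr \<gamma>" using that assms by (intro powr_mono2) auto
      also have "\<dots> = \<alpha> powr \<gamma> * x" using assms by (simp add: powr_mult x_def)
      finally have "C * card X powr \<gamma> \<le> C * \<alpha> powr \<gamma> * x"
        using C(1) by (simp add: mult_left_mono mult.assoc)
      then show ?thesis using p assms fin finW that
        by (intro poincare_mono[OF p] powr_mono) (auto intro: finite_subset)
    qed
    have "poincare E lam (A \<union> B) (2 * ?T)"
      using W fin assms by (intro poincare_Un part) auto
    moreover have "W - S = A \<union> B" using W by auto
    ultimately have p: "poincare E lam W (6 * real (card W) * hardcore_Z (S, E) lam
         + 3 * (hardcore_Z (S, E) lam)\<^sup>2 * (2 * ?T))"
      using W(1) finW assms by (intro poincare_separator) auto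
    have Z: "hardcore_Z (S, E) lam \<le> L powr (c * x)" "hardcore_Z (S, E) lam \<ge> 0"
      using W(7) hardcore_Z_ge_1[of S lam E] fin assms by (auto simp: x_def)
    \<comment> \<open>The exponent \<open>8 * x\<close> is spent as \<open>3 * x\<close> on the
      factor 6, \<open>4 * x\<close> on \<open>card W\<close>, and \<open>x\<close> on adding the
      two terms of the bound.\<close>
    have "6 \<le> (2::real) powr 3" by simp
    also have "\<dots> \<le> L powr 3" using assms by (intro powr_mono2) auto
    also have "\<dots> \<le> L powr (3 * x)" using assms x1 by (intro powr_mono) auto
    finally have six: "6 \<le> L powr (3 * x)" .
    have "6 * real (card W) * hardcore_Z (S, E) lam \<le> L powr (3 * x) * L powr (4 * x) * L powr (c * x)"
      using six Z of_nat_le_powr[OF n1 assms(3,4)] by (intro mult_mono) (auto simp: x_def)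
    also have "\<dots> = L powr (7 * x + c * x)" using assms by (simp add: powr_add[symmetric] algebra_simps)
    also have "\<dots> \<le> L powr ((2 * c + 7 + C * \<alpha> powr \<gamma>) * x)"
    proof (rule powr_mono)
      have "0 \<le> c * x" "0 \<le> C * \<alpha> powr \<gamma> * x" using C assms x1 by auto
      then show "7 * x + c * x \<le> (2 * c + 7 + C * \<alpha> powr \<gamma>) * x" by (simp add: algebra_simps)
    qed (use assms in auto)
    finally have 1: "6 * real (card W) * hardcore_Z (S, E) lam \<le> L powr ((2 * c + 7 + C * \<alpha> powr \<gamma>) * x)" .
    have "3 * (hardcore_Z (S, E) lam)\<^sup>2 * (2 * ?T) = 6 * (hardcore_Z (S, E) lam)\<^sup>2 * ?T" by simp
    also have "\<dots> \<le> L powr (3 * x) * (L powr (c * x))\<^sup>2 * ?T"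
      using six Z by (intro mult_mono power_mono) auto
    also have "\<dots> = L powr (3 * x + 2 * c * x + C * \<alpha> powr \<gamma> * x)"
      using assms by (simp add: powr_add[symmetric] power2_eq_square algebra_simps)
    also have "\<dots> \<le> L powr ((2 * c + 7 + C * \<alpha> powr \<gamma>) * x)"
      using x1 assms by (intro powr_mono) (auto simp: algebra_simps)
    finally have 2: "3 * (hardcore_Z (S, E) lam)\<^sup>2 * (2 * ?T) \<le> L powr ((2 * c + 7 + C * \<alpha> powr \<gamma>) * x)" .
    have "6 * real (card W) * hardcore_Z (S, E) lam + 3 * (hardcore_Z (S, E) lam)\<^sup>2 * (2 * ?T)
        \<le> 2 * L powr ((2 * c + 7 + C * \<alpha> powr \<gamma>) * x)"
      using 1 2 by linarith
    also have "\<dots> \<le> L powr x * L powr ((2 * c + 7 + C * \<alpha> powr \<gamma>) * x)"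
    proof (rule mult_right_mono)
      have "L powr 1 \<le> L powr x" using x1 assms by (intro powr_mono) auto
      then show "2 \<le> L powr x" using assms by simp
    qed simp
    also have "\<dots> = L powr ((2 * c + 8 + C * \<alpha> powr \<gamma>) * x)"
      by (simp add: powr_add[symmetric] algebra_simps)
    also have "\<dots> = L powr (C * x)"
      using C(2) by simp
    finally show ?thesis
      using poincare_mono[OF p] finW assms unfolding C_def x_def by blast
  qed
qed

section \<open>The single-site update\<close>

text \<open>The update at one fixed vertex is isolated because it, rather than the whole Glauber
  step, acts as a projection.\<close>

definition site_step :: "'v graph \<Rightarrow> real \<Rightarrow> 'v \<Rightarrow> 'v set \<Rightarrow> 'v set pmf" where
  "site_step G lam v I =
     (if v \<in> I then
         map_pmf (\<lambda>b. if b then I - {v} else I) (bernoulli_pmf (1 / (lam + 1)))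
       else if insert v I \<in> indep_sets_of G then
         map_pmf (\<lambda>b. if b then insert v I else I) (bernoulli_pmf (lam / (lam + 1)))
       else return_pmf I)"

lemma glauber_step_eq: "glauber_step G lam I = bind_pmf (pmf_of_set (fst G)) (\<lambda>v. site_step G lam v I)"
  by (simp add: glauber_step_def site_step_def)

lemma pmf_map_bernoulli:
  assumes "0 \<le> p" "p \<le> 1"
  shows "pmf (map_pmf (\<lambda>b. if b then X else Y) (bernoulli_pmf p)) K = p * of_bool (X = K) + (1 - p) * of_bool (Y = K)"
  using assms by (simp add: map_pmf_def pmf_bind indicator_def)

lemma pmf_site_step:
  assumes "lam > 0"
  shows "pmf (site_step G lam v I) K =
     (if v \<in> I then 1 / (lam + 1) * of_bool (I - {v} = K) + lam / (lam + 1) * of_bool (I = K)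
      else if insert v I \<in> indep_sets_of G
      then lam / (lam + 1) * of_bool (insert v I = K) + 1 / (lam + 1) * of_bool (I = K)
      else of_bool (I = K))"
proof -
  have "1 - 1 / (lam + 1) = lam / (lam + 1)" "1 - lam / (lam + 1) = 1 / (lam + 1)"
    using assms by (auto simp: field_simps)
  moreover have "0 \<le> 1 / (lam + 1)" "1 / (lam + 1) \<le> 1" "0 \<le> lam / (lam + 1)" "lam / (lam + 1) \<le> 1"
    using assms by auto
  ultimately show ?thesis
    by (simp only: site_step_def pmf_map_bernoulli if_distrib[of "\<lambda>p. pmf p K"] pmf_return indicator_def)
      (auto simp: of_bool_def)
qed

text \<open>The only nontrivial transitions are between \<open>J\<close> and
  \<open>insert v J\<close>: the extra factor \<open>lam\<close> in the weight of the larger set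
  matches the ratio of the probabilities of adding and removing.\<close>

lemma site_step_reversible:
  assumes "lam > 0" "finite (fst G)" "J \<in> indep_sets_of G" "K \<in> indep_sets_of G"
  shows "lam ^ card K * pmf (site_step G lam v K) J = lam ^ card J * pmf (site_step G lam v J) K"
proof -
  have fin: "finite J" "finite K"
    using assms(2-4) by (auto simp: indep_sets_of_def intro: finite_subset)
  consider "J = K" | "v \<notin> J" "K = insert v J" | "v \<notin> K" "J = insert v K"
    | "J \<noteq> K" "\<not> (v \<notin> J \<and> K = insert v J)" "\<not> (v \<notin> K \<and> J = insert v K)" by blast
  then show ?thesis
  proof cases
    case 4
    then have "K \<noteq> J" "v \<in> K \<Longrightarrow> K - {v} \<noteq> J" "v \<notin> K \<Longrightarrow> insert v K \<noteq> J"
      "v \<in> J \<Longrightarrow> J - {v} \<noteq> K" "v \<notin> J \<Longrightarrow> insert v J \<noteq> K"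
      by (metis Diff_iff insert_Diff singletonI)+
    then have "pmf (site_step G lam v K) J = 0" "pmf (site_step G lam v J) K = 0"
      using 4(1) by (simp_all add: pmf_site_step[OF assms(1)])
    then show ?thesis by simp
  qed (use assms fin in \<open>auto simp: pmf_site_step\<close>)
qed

lemma sum_of_bool_mult:
  fixes f :: "'b \<Rightarrow> real"
  assumes "finite A" "a \<in> A"
  shows "(\<Sum>x\<in>A. of_bool (a = x) * f x) = f a"
proof -
  have "(\<Sum>x\<in>A. of_bool (a = x) * f x) = (\<Sum>x\<in>A. if a = x then f x else 0)"
    by (intro sum.cong) auto
  then show ?thesis using assms by simp
qed

text \<open>The update replaces \<open>f\<close> by its conditional mean given the state off
  \<open>v\<close>.\<close>

lemma site_average_eq:
  assumes "lam > 0" "finite (fst G)" "I \<in> indep_sets_of G"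
  shows "(\<Sum>K\<in>indep_sets_of G. pmf (site_step G lam v I) K * f K) =
     (if v \<in> I then (f (I - {v}) + lam * f I) / (lam + 1)
      else if insert v I \<in> indep_sets_of G then (f I + lam * f (insert v I)) / (lam + 1)
      else f I)"
proof -
  have fin: "finite (indep_sets_of G)"
    using finite_indep[of "fst G" "snd G"] assms by simp
  have sub: "I - {v} \<in> indep_sets_of G"
    using indep_subset[of I "fst G" "snd G" "I - {v}"] assms by simp
  have *: "(\<Sum>K\<in>indep_sets_of G. (p * of_bool (X = K) + q * of_bool (I = K)) * f K) = p * f X + q * f I"
    if "X \<in> indep_sets_of G" for p q X
  proof -
    have "(\<Sum>K\<in>indep_sets_of G. (p * of_bool (X = K) + q * of_bool (I = K)) * f K)
      = p * (\<Sum>K\<in>indep_sets_of G. of_bool (X = K) * f K) + q * (\<Sum>K\<in>indep_sets_of G. of_bool (I = K) * f K)"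
      by (simp only: sum_distrib_left sum.distrib distrib_right mult.assoc)
    then show ?thesis using that assms(3) fin by (simp add: sum_of_bool_mult)
  qed
  show ?thesis
  proof (cases "v \<in> I")
    case True
    then show ?thesis
      by (simp only: pmf_site_step[OF assms(1)] if_True *[OF sub]) (simp add: add_divide_distrib)
  next
    case False
    show ?thesis
    proof (cases "insert v I \<in> indep_sets_of G")
      case True
      then show ?thesis
        using False by (simp only: pmf_site_step[OF assms(1)] if_True if_False *) (simp add: add_divide_distrib)
    next
      assume "insert v I \<notin> indep_sets_of G"
      then show ?thesis
        using False assms(3) fin by (simp add: pmf_site_step[OF assms(1)] sum_of_bool_mult)
    qed
  qed
qed

text \<open>Decomposition of a second moment into squared mean and variance, for two points of
  weights 1 and \<open>l\<close>.\<close>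

lemma convex_square: "a\<^sup>2 + l * b\<^sup>2 = (1 + l) * ((a + l * b) / (l + 1))\<^sup>2 + l / (l + 1) * (b - a)\<^sup>2"
  if "l > 0" for a b l :: real
proof -
  have "(1 + l) * ((a + l * b) / (l + 1))\<^sup>2 = (a + l * b)\<^sup>2 / (l + 1)"
    using that by (simp add: power2_eq_square add.commute)
  then have "(1 + l) * ((a + l * b) / (l + 1))\<^sup>2 + l / (l + 1) * (b - a)\<^sup>2
      = ((a + l * b)\<^sup>2 + l * (b - a)\<^sup>2) / (l + 1)"
    by (simp add: add_divide_distrib)
  also have "(a + l * b)\<^sup>2 + l * (b - a)\<^sup>2 = (a\<^sup>2 + l * b\<^sup>2) * (l + 1)"
    by (simp add: power2_eq_square algebra_simps)
  finally show ?thesis using that by simp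
qed

text \<open>The single-site update is an orthogonal projection, so it decreases the squared norm by
  exactly its Dirichlet form.\<close>

lemma site_average_norm:
  fixes f :: "'v set \<Rightarrow> real"
  assumes "lam > 0" "finite (fst G)"
  shows "(\<Sum>I\<in>indep_sets_of G. lam ^ card I * (\<Sum>K\<in>indep_sets_of G. pmf (site_step G lam v I) K * f K)\<^sup>2)
    = (\<Sum>I\<in>indep_sets_of G. lam ^ card I * (f I)\<^sup>2)
      - 1 / (lam + 1) * (\<Sum>K | K \<in> indep_sets_of G \<and> v \<in> K. lam ^ card K * (f K - f (K - {v}))\<^sup>2)"
proof -
  obtain W E where G_def: "G = (W, E)" by (cases G)
  let ?\<Omega> = "indep_sets_of G"
  \<comment> \<open>The states fall into pairs \<open>K\<close>, \<open>K - {v}\<close> with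
    \<open>K\<close> in \<open>U\<close>, on which the update averages, and the set \<open>R\<close>
    of states where \<open>v\<close> is blocked, which it fixes.\<close>
  define U where "U = {K \<in> ?\<Omega>. v \<in> K}"
  define D where "D = (\<lambda>K. K - {v}) ` U"
  define R where "R = ?\<Omega> - U - D"
  have fin: "finite ?\<Omega>" using assms by (simp add: G_def)
  have inj: "inj_on (\<lambda>K. K - {v}) U" by (auto simp: inj_on_def U_def)
  have DO: "D \<subseteq> ?\<Omega>" by (auto simp: D_def U_def G_def intro: indep_subset)
  have disj: "U \<inter> D = {}" by (auto simp: D_def U_def)
  have split: "(\<Sum>I\<in>?\<Omega>. h I) = (\<Sum>K\<in>U. h (K - {v}) + h K) + (\<Sum>I\<in>R. h I)" for h :: "'v set \<Rightarrow> real"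
  proof -
    have "?\<Omega> = (U \<union> D) \<union> R" using DO by (auto simp: R_def U_def)
    moreover have "finite U" "finite D" "finite R" using fin by (auto simp: U_def D_def R_def)
    moreover have "(U \<union> D) \<inter> R = {}" by (auto simp: R_def)
    ultimately have "(\<Sum>I\<in>?\<Omega>. h I) = (\<Sum>I\<in>U. h I) + (\<Sum>I\<in>D. h I) + (\<Sum>I\<in>R. h I)"
      using disj by (simp add: sum.union_disjoint)
    also have "(\<Sum>I\<in>D. h I) = (\<Sum>I\<in>U. h (I - {v}))"
      unfolding D_def using inj by (simp add: sum.reindex)
    finally show ?thesis by (simp add: sum.distrib)
  qed
  let ?A = "\<lambda>I. \<Sum>K\<in>?\<Omega>. pmf (site_step G lam v I) K * f K"
  have A_R: "?A I = f I" if "I \<in> R" for I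
  proof -
    have "I \<in> ?\<Omega>" "v \<notin> I" using that by (auto simp: R_def U_def)
    moreover have "insert v I \<notin> ?\<Omega>"
    proof
      assume "insert v I \<in> ?\<Omega>"
      then have "insert v I \<in> U" by (simp add: U_def)
      moreover have "I = insert v I - {v}" using \<open>v \<notin> I\<close> by simp
      ultimately have "I \<in> D" unfolding D_def by (rule rev_image_eqI)
      then show False using that by (simp add: R_def)
    qed
    ultimately show ?thesis by (simp add: site_average_eq[OF assms])
  qed
  \<comment> \<open>On a pair this is \<open>convex_square\<close> scaled by the weight of the
    smaller set; the extra \<open>lam\<close> in its variance term turns that weight into the weight
    of \<open>K\<close>.\<close>
  have A_U: "lam ^ card (K - {v}) * (?A (K - {v}))\<^sup>2 + lam ^ card K * (?A K)\<^sup>2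
      = lam ^ card (K - {v}) * (f (K - {v}))\<^sup>2 + lam ^ card K * (f K)\<^sup>2
        - 1 / (lam + 1) * (lam ^ card K * (f K - f (K - {v}))\<^sup>2)" if "K \<in> U" for K
  proof -
    have K: "K \<in> ?\<Omega>" "v \<in> K" using that by (auto simp: U_def)
    have K': "K - {v} \<in> ?\<Omega>" using DO that by (auto simp: D_def)
    have "finite K" using K assms(2) indep_finite[of W K E] by (auto simp: G_def)
    then have c: "lam ^ card K = lam * lam ^ card (K - {v})"
      using K(2) by (metis card.remove power_Suc)
    have A: "?A K = (f (K - {v}) + lam * f K) / (lam + 1)"
      "?A (K - {v}) = (f (K - {v}) + lam * f K) / (lam + 1)"
      using K K' by (simp_all add: site_average_eq[OF assms] insert_absorb)
    have "lam ^ card (K - {v}) * (?A (K - {v}))\<^sup>2 + lam ^ card K * (?A K)\<^sup>2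
      = lam ^ card (K - {v}) * ((1 + lam) * ((f (K - {v}) + lam * f K) / (lam + 1))\<^sup>2)"
      unfolding A c by (simp add: algebra_simps)
    also have "\<dots> = lam ^ card (K - {v}) * ((f (K - {v}))\<^sup>2 + lam * (f K)\<^sup>2
       - lam / (lam + 1) * (f K - f (K - {v}))\<^sup>2)"
      using convex_square[OF assms(1), of "f (K - {v})" "f K"] by simp
    also have "\<dots> = lam ^ card (K - {v}) * (f (K - {v}))\<^sup>2 + lam ^ card K * (f K)\<^sup>2
        - 1 / (lam + 1) * (lam ^ card K * (f K - f (K - {v}))\<^sup>2)"
      unfolding c by (simp add: algebra_simps)
    finally show ?thesis .
  qed
  have "(\<Sum>I\<in>?\<Omega>. lam ^ card I * (?A I)\<^sup>2)
     = (\<Sum>K\<in>U. lam ^ card (K - {v}) * (?A (K - {v}))\<^sup>2 + lam ^ card K * (?A K)\<^sup>2)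
       + (\<Sum>I\<in>R. lam ^ card I * (?A I)\<^sup>2)"
    by (rule split)
  also have "\<dots> = (\<Sum>K\<in>U. lam ^ card (K - {v}) * (f (K - {v}))\<^sup>2 + lam ^ card K * (f K)\<^sup>2
        - 1 / (lam + 1) * (lam ^ card K * (f K - f (K - {v}))\<^sup>2)) + (\<Sum>I\<in>R. lam ^ card I * (f I)\<^sup>2)"
    by (intro arg_cong2[where f = "(+)"] sum.cong refl A_U) (simp_all only: A_R)
  also have "\<dots> = (\<Sum>I\<in>?\<Omega>. lam ^ card I * (f I)\<^sup>2)
     - 1 / (lam + 1) * (\<Sum>K\<in>U. lam ^ card K * (f K - f (K - {v}))\<^sup>2)"
    unfolding split by (simp add: sum_subtractf sum_distrib_left)
  finally show ?thesis by (simp only: U_def)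
qed

section \<open>From the Poincare inequality to the mixing time\<close>

lemma glauber_step_support:
  assumes "finite (fst G)" "fst G \<noteq> {}" "I \<in> indep_sets_of G"
  shows "set_pmf (glauber_step G lam I) \<subseteq> indep_sets_of G"
proof -
  have "I - {v} \<in> indep_sets_of G" for v
    using indep_subset[of I "fst G" "snd G" "I - {v}"] assms by simp
  then have "set_pmf (site_step G lam v I) \<subseteq> indep_sets_of G" for v
    using assms(3) by (auto simp: site_step_def image_subset_iff)
  then show ?thesis by (auto simp: glauber_step_eq)
qed

lemma glauber_step_reversible:
  assumes "lam > 0" "finite (fst G)" "fst G \<noteq> {}" "J \<in> indep_sets_of G" "K \<in> indep_sets_of G"
  shows "lam ^ card K * pmf (glauber_step G lam K) J = lam ^ card J * pmf (glauber_step G lam J) K"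
  using site_step_reversible[OF assms(1,2,4,5)] assms(2,3)
  by (simp add: glauber_step_eq pmf_bind_pmf_of_set sum_distrib_left)

text \<open>The transition operator averages the single-site projections, so by Cauchy-Schwarz its
  squared norm is at most the mean of theirs, and each of them loses its own share of the
  energy.\<close>

lemma glauber_average_norm_le:
  fixes f :: "'v set \<Rightarrow> real" and lam :: real and W :: "'v set" and E :: "'v set set"
  assumes "lam > 0" "finite W" "W \<noteq> {}"
  defines "G \<equiv> (W, E)"
  shows "(\<Sum>I\<in>indep_sets_of G. lam ^ card I * (\<Sum>K\<in>indep_sets_of G. pmf (glauber_step G lam I) K * f K)\<^sup>2)
    \<le> (\<Sum>I\<in>indep_sets_of G. lam ^ card I * (f I)\<^sup>2) - energy E lam W f / (card W * (lam + 1))"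
proof -
  let ?\<Omega> = "indep_sets_of G"
  let ?A = "\<lambda>v I. \<Sum>K\<in>?\<Omega>. pmf (site_step G lam v I) K * f K"
  let ?N = "\<Sum>I\<in>?\<Omega>. lam ^ card I * (f I)\<^sup>2"
  let ?n = "real (card W)"
  have n: "?n > 0" using assms by (simp add: card_gt_0_iff)
  have *: "(\<Sum>K\<in>?\<Omega>. pmf (glauber_step G lam I) K * f K)\<^sup>2 \<le> (\<Sum>v\<in>W. (?A v I)\<^sup>2) / ?n" for I
  proof -
    have "(\<Sum>K\<in>?\<Omega>. pmf (glauber_step G lam I) K * f K) = (\<Sum>K\<in>?\<Omega>. \<Sum>v\<in>W. pmf (site_step G lam v I) K * f K) / ?n"
      using assms(2,3)
      by (simp add: glauber_step_eq pmf_bind_pmf_of_set G_def sum_divide_distrib sum_distrib_right)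
    also have "\<dots> = (\<Sum>v\<in>W. ?A v I) / ?n"
      by (simp only: sum.swap[of _ ?\<Omega> W])
    finally have "(\<Sum>K\<in>?\<Omega>. pmf (glauber_step G lam I) K * f K)\<^sup>2 = (\<Sum>v\<in>W. 1 * ?A v I)\<^sup>2 / ?n\<^sup>2"
      by (simp add: power_divide)
    also have "\<dots> \<le> (\<Sum>v\<in>W. 1\<^sup>2) * (\<Sum>v\<in>W. (?A v I)\<^sup>2) / ?n\<^sup>2"
      by (intro divide_right_mono Cauchy_Schwarz_ineq_sum) auto
    also have "\<dots> = (\<Sum>v\<in>W. (?A v I)\<^sup>2) / ?n"
      using n by (simp add: power2_eq_square)
    finally show ?thesis .
  qed
  have "(\<Sum>I\<in>?\<Omega>. lam ^ card I * (\<Sum>K\<in>?\<Omega>. pmf (glauber_step G lam I) K * f K)\<^sup>2)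
     \<le> (\<Sum>I\<in>?\<Omega>. lam ^ card I * ((\<Sum>v\<in>W. (?A v I)\<^sup>2) / ?n))"
    using * assms(1) by (intro sum_mono mult_left_mono) auto
  also have "\<dots> = (\<Sum>I\<in>?\<Omega>. \<Sum>v\<in>W. lam ^ card I * (?A v I)\<^sup>2) / ?n"
    by (simp only: sum_distrib_left sum_divide_distrib times_divide_eq_right)
  also have "\<dots> = (\<Sum>v\<in>W. \<Sum>I\<in>?\<Omega>. lam ^ card I * (?A v I)\<^sup>2) / ?n"
    by (simp only: sum.swap[of _ ?\<Omega> W])
  also have "\<dots> = (\<Sum>v\<in>W. ?N - 1 / (lam + 1) *
      (\<Sum>K | K \<in> ?\<Omega> \<and> v \<in> K. lam ^ card K * (f K - f (K - {v}))\<^sup>2)) / ?n"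
    using assms(1,2) by (simp only: site_average_norm G_def fst_conv)
  also have "\<dots> = (?n * ?N - energy E lam W f / (lam + 1)) / ?n"
    by (simp add: sum_subtractf sum_divide_distrib[symmetric] energy_def G_def)
  also have "\<dots> = ?N - energy E lam W f / (card W * (lam + 1))"
    using n by (simp add: diff_divide_distrib mult.commute)
  finally show ?thesis .
qed

lemma glauber_contraction:
  fixes f :: "'v set \<Rightarrow> real" and lam :: real and W :: "'v set" and E :: "'v set set"
  assumes "lam > 0" "finite W" "W \<noteq> {}" "poincare E lam W T" "T > 0"
    and mean: "(\<Sum>I\<in>indep_sets_of (W, E). lam ^ card I * f I) = 0"
  defines "G \<equiv> (W, E)"
  shows "(\<Sum>I\<in>indep_sets_of G. lam ^ card I * (\<Sum>K\<in>indep_sets_of G. pmf (glauber_step G lam I) K * f K)\<^sup>2)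
    \<le> exp (- 2 / (T * card W * (lam + 1))) * (\<Sum>I\<in>indep_sets_of G. lam ^ card I * (f I)\<^sup>2)"
proof -
  let ?\<Omega> = "indep_sets_of G"
  let ?N = "\<Sum>I\<in>?\<Omega>. lam ^ card I * (f I)\<^sup>2"
  let ?n = "real (card W)"
  let ?Z = "hardcore_Z G lam"
  have n: "?n > 0" using assms by (simp add: card_gt_0_iff)
  have Z: "?Z > 0" using hardcore_Z_ge_1[of W lam E] assms by (simp add: G_def)
  have N: "?N \<ge> 0" using assms by (intro sum_nonneg) auto
  \<comment> \<open>Expanding the square, the cross term vanishes because \<open>f\<close> has mean
    zero, so the double sum is \<open>2 * ?Z * ?N\<close>.\<close>
  have "dvar E lam W f = (\<Sum>I\<in>?\<Omega>. lam ^ card I * ((f I)\<^sup>2 * ?Z + ?N - 2 * f I * (\<Sum>J\<in>?\<Omega>. lam ^ card J * f J)))"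
    unfolding dvar_def hardcore_Z_def G_def
    by (intro sum.cong arg_cong2[where f = "(*)"] refl)
      (simp add: sum_distrib_left sum.distrib[symmetric] sum_subtractf[symmetric] power2_eq_square algebra_simps)
  also have "\<dots> = (\<Sum>I\<in>?\<Omega>. lam ^ card I * (f I)\<^sup>2 * ?Z) + (\<Sum>I\<in>?\<Omega>. lam ^ card I * ?N)"
    using mean by (simp add: G_def[symmetric] sum.distrib[symmetric] distrib_left mult.assoc)
  also have "\<dots> = 2 * ?Z * ?N"
    by (simp only: sum_distrib_right[symmetric]) (simp add: hardcore_Z_def)
  finally have "2 * ?Z * ?N \<le> T * ?Z * energy E lam W f"
    using assms(4)[unfolded poincare_def, rule_format, of f] by (simp add: G_def)
  then have "2 * ?N \<le> T * energy E lam W f" using Z by (simp add: mult.assoc mult.left_commute)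
  then have "2 / (T * ?n * (lam + 1)) * ?N \<le> energy E lam W f / (?n * (lam + 1))"
  proof -
    assume "2 * ?N \<le> T * energy E lam W f"
    then have "2 * ?N / T \<le> energy E lam W f"
      using \<open>T > 0\<close> by (simp add: pos_divide_le_eq mult.commute)
    then have "2 * ?N / T / (?n * (lam + 1)) \<le> energy E lam W f / (?n * (lam + 1))"
      using assms(1) by (intro divide_right_mono) auto
    then show ?thesis by (simp only: divide_divide_eq_left times_divide_eq_left mult.assoc)
  qed
  then have "?N - energy E lam W f / (?n * (lam + 1)) \<le> (1 + (- 2 / (T * ?n * (lam + 1)))) * ?N"
    by (simp add: algebra_simps)
  also have "\<dots> \<le> exp (- 2 / (T * ?n * (lam + 1))) * ?N"
    using N by (intro mult_right_mono exp_ge_add_one_self) auto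
  finally show ?thesis
    using glauber_average_norm_le[OF assms(1-3), of E f] by (simp add: G_def)
qed

lemma glauber_dist_Suc: "glauber_dist G lam I (Suc t) = bind_pmf (glauber_dist G lam I t) (glauber_step G lam)"
  by (simp add: glauber_dist_def)

lemma glauber_dist_support:
  assumes "finite (fst G)" "fst G \<noteq> {}" "I \<in> indep_sets_of G"
  shows "set_pmf (glauber_dist G lam I t) \<subseteq> indep_sets_of G"
proof (induction t)
  case 0
  then show ?case using assms by (simp add: glauber_dist_def)
next
  case (Suc t)
  then show ?case using glauber_step_support[OF assms(1,2)] by (fastforce simp: glauber_dist_Suc)
qed

text \<open>By reversibility, the density of the chain with respect to the stationary distribution
  evolves under the transition operator itself.\<close>

lemma glauber_density_Suc:
  assumes "lam > 0" "finite (fst G)" "fst G \<noteq> {}" "I \<in> indep_sets_of G" "J \<in> indep_sets_of G"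
  shows "pmf (glauber_dist G lam I (Suc t)) J / lam ^ card J - c
    = (\<Sum>K\<in>indep_sets_of G. pmf (glauber_step G lam J) K * (pmf (glauber_dist G lam I t) K / lam ^ card K - c))"
proof -
  let ?\<Omega> = "indep_sets_of G" and ?\<mu> = "glauber_dist G lam I t"
  have fin: "finite ?\<Omega>" using finite_indep[of "fst G" "snd G"] assms by simp
  have "pmf (glauber_dist G lam I (Suc t)) J = (\<Sum>K\<in>?\<Omega>. pmf (glauber_step G lam K) J * pmf ?\<mu> K)"
    unfolding glauber_dist_Suc pmf_bind
    using glauber_dist_support[OF assms(2-4), of lam t] fin
    by (intro integral_measure_pmf_real) auto
  \<comment> \<open>Detailed balance turns the column of the kernel into its row at
    \<open>J\<close>, which is where the density is evaluated.\<close>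
  also have "\<dots> = (\<Sum>K\<in>?\<Omega>. lam ^ card J * (pmf (glauber_step G lam J) K * (pmf ?\<mu> K / lam ^ card K)))"
    using glauber_step_reversible[OF assms(1-3) assms(5)] assms(1)
    by (intro sum.cong refl) (simp add: field_simps)
  also have "\<dots> = lam ^ card J * (\<Sum>K\<in>?\<Omega>. pmf (glauber_step G lam J) K * (pmf ?\<mu> K / lam ^ card K))"
    by (rule sum_distrib_left[symmetric])
  finally have "pmf (glauber_dist G lam I (Suc t)) J / lam ^ card J
      = (\<Sum>K\<in>?\<Omega>. pmf (glauber_step G lam J) K * (pmf ?\<mu> K / lam ^ card K))"
    using assms(1) by simp
  \<comment> \<open>Constants are fixed by the operator, so subtracting \<open>c\<close> commutes
    with the step.\<close>
  moreover have "(\<Sum>K\<in>?\<Omega>. pmf (glauber_step G lam J) K * c) = c"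
    using sum_pmf_eq_1[OF fin glauber_step_support[OF assms(2,3,5)]]
    by (simp add: sum_distrib_right[symmetric])
  ultimately show ?thesis by (simp add: right_diff_distrib sum_subtractf)
qed

text \<open>The centred density contracts in every step. Cauchy-Schwarz bounds the squared sum of
  absolute differences by the partition function times the squared norm; distance 1/4 means that
  this sum is at most 1/2, hence the 4 in the condition on \<open>t\<close>.\<close>

lemma glauber_tv_le:
  fixes W :: "'v set" and E :: "'v set set"
  assumes "lam > 0" "finite W" "W \<noteq> {}" "poincare E lam W T" "T > 0" "I \<in> indep_sets_of (W, E)"
  defines "G \<equiv> (W, E)"
  assumes t: "4 * hardcore_Z G lam / lam ^ card I \<le> exp (2 / (T * card W * (lam + 1)) * real t)"
  shows "tv_dist (indep_sets_of G) (pmf (glauber_dist G lam I t)) (hardcore G lam) \<le> 1 / 4"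
proof -
  let ?\<Omega> = "indep_sets_of G" and ?Z = "hardcore_Z G lam"
  \<comment> \<open>Density with respect to the unnormalised weights, minus its equilibrium value
    \<open>1 / ?Z\<close>.\<close>
  define f where "f = (\<lambda>s J. pmf (glauber_dist G lam I s) J / lam ^ card J - 1 / ?Z)"
  let ?N = "\<lambda>s. \<Sum>J\<in>?\<Omega>. lam ^ card J * (f s J)\<^sup>2"
  define r where "r = 2 / (T * card W * (lam + 1))"
  have G: "finite (fst G)" "fst G \<noteq> {}" "I \<in> ?\<Omega>" using assms by (auto simp: G_def)
  have fin: "finite ?\<Omega>" using assms by (simp add: G_def)
  have Z: "?Z \<ge> 1" using hardcore_Z_ge_1[of W lam E] assms by (simp add: G_def)
  have mean: "(\<Sum>J\<in>?\<Omega>. lam ^ card J * f s J) = 0" for s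
  proof -
    have "(\<Sum>J\<in>?\<Omega>. lam ^ card J * f s J) = (\<Sum>J\<in>?\<Omega>. pmf (glauber_dist G lam I s) J) - (\<Sum>J\<in>?\<Omega>. lam ^ card J) / ?Z"
      using assms(1) by (simp add: f_def right_diff_distrib sum_subtractf sum_divide_distrib)
    also have "\<dots> = 1 - ?Z / ?Z"
      using sum_pmf_eq_1[OF fin glauber_dist_support[OF G]] by (simp add: hardcore_Z_def)
    finally show ?thesis using Z by simp
  qed
  have "?N s \<le> exp (- r * real s) * (1 / lam ^ card I)" for s
  proof (induction s)
    case 0
    \<comment> \<open>Starting from a point mass at \<open>I\<close>, the squared norm is
      \<open>1 / lam ^ card I - 1 / ?Z\<close>.\<close>
    have "lam ^ card J * (f 0 J)\<^sup>2 = of_bool (J = I) / lam ^ card I - of_bool (J = I) * 2 / ?Z + lam ^ card J / ?Z\<^sup>2" for J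
      using assms(1) Z by (auto simp: f_def glauber_dist_def power2_eq_square field_simps indicator_def)
    then have "?N 0 = (\<Sum>J\<in>?\<Omega>. if J = I then 1 / lam ^ card I - 2 / ?Z else 0) + (\<Sum>J\<in>?\<Omega>. lam ^ card J / ?Z\<^sup>2)"
      by (simp only: sum.distrib[symmetric]) (auto intro!: sum.cong)
    also have "\<dots> = 1 / lam ^ card I - 2 / ?Z + ?Z / ?Z\<^sup>2"
      using G fin by (simp add: hardcore_Z_def sum_divide_distrib)
    also have "\<dots> = 1 / lam ^ card I - 1 / ?Z"
      using Z by (simp add: power2_eq_square)
    also have "\<dots> \<le> 1 / lam ^ card I" using Z by simp
    finally show ?case by simp
  next
    case (Suc s)
    have "?N (Suc s) = (\<Sum>J\<in>?\<Omega>. lam ^ card J * (\<Sum>K\<in>?\<Omega>. pmf (glauber_step G lam J) K * f s K)\<^sup>2)"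
      unfolding f_def using glauber_density_Suc[OF assms(1) G] by (intro sum.cong refl) simp
    also have "\<dots> \<le> exp (- r) * ?N s"
      using glauber_contraction[OF assms(1-5), of "f s"] mean by (simp add: G_def r_def)
    also have "\<dots> \<le> exp (- r) * (exp (- r * real s) * (1 / lam ^ card I))"
      using Suc by (intro mult_left_mono) auto
    also have "\<dots> = exp (- r * real (Suc s)) * (1 / lam ^ card I)"
      by (simp add: exp_add[symmetric] algebra_simps)
    finally show ?case .
  qed
  then have N: "?N t \<le> exp (- r * real t) * (1 / lam ^ card I)" .
  \<comment> \<open>The weight is split into two square roots in preparation for
    Cauchy-Schwarz.\<close>
  have "(\<Sum>J\<in>?\<Omega>. \<bar>pmf (glauber_dist G lam I t) J - hardcore G lam J\<bar>)
      = (\<Sum>J\<in>?\<Omega>. sqrt (lam ^ card J) * (sqrt (lam ^ card J) * \<bar>f t J\<bar>))"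
  proof (intro sum.cong refl)
    fix J
    have "pmf (glauber_dist G lam I t) J - hardcore G lam J = lam ^ card J * f t J"
      using assms(1) by (simp add: f_def hardcore_def right_diff_distrib)
    then show "\<bar>pmf (glauber_dist G lam I t) J - hardcore G lam J\<bar> = sqrt (lam ^ card J) * (sqrt (lam ^ card J) * \<bar>f t J\<bar>)"
      using assms(1) by (simp add: abs_mult mult.assoc[symmetric])
  qed
  then have "(\<Sum>J\<in>?\<Omega>. \<bar>pmf (glauber_dist G lam I t) J - hardcore G lam J\<bar>)\<^sup>2
     \<le> (\<Sum>J\<in>?\<Omega>. (sqrt (lam ^ card J))\<^sup>2) * (\<Sum>J\<in>?\<Omega>. (sqrt (lam ^ card J) * \<bar>f t J\<bar>)\<^sup>2)"
    using Cauchy_Schwarz_ineq_sum by metis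
  also have "\<dots> = ?Z * ?N t"
    using assms(1) by (simp add: hardcore_Z_def power_mult_distrib)
  also have "\<dots> \<le> ?Z * (exp (- r * real t) * (1 / lam ^ card I))"
    using N Z by (intro mult_left_mono) auto
  also have "\<dots> \<le> (1 / 2)\<^sup>2"
  proof -
    have "4 * ?Z / lam ^ card I * exp (- r * real t) \<le> exp (r * real t) * exp (- r * real t)"
      using t by (intro mult_right_mono) (auto simp: r_def)
    also have "\<dots> = 1" by (simp add: exp_add[symmetric])
    finally show ?thesis by (simp add: power2_eq_square mult_ac)
  qed
  finally have "(\<Sum>J\<in>?\<Omega>. \<bar>pmf (glauber_dist G lam I t) J - hardcore G lam J\<bar>) \<le> 1 / 2"
    by (rule power2_le_imp_le) simp
  then show ?thesis by (simp add: tv_dist_def)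
qed

section \<open>The number of steps and the clique weights in terms of
  \<open>2 * exp \<bar>ln lam\<bar>\<close>\<close>

text \<open>\<open>exp \<bar>ln lam\<bar>\<close> is the larger of \<open>lam\<close> and
  \<open>1 / lam\<close>.\<close>

lemma fugacity_bounds:
  fixes lam :: real
  assumes "lam > 0"
  shows "1 \<le> exp \<bar>ln lam\<bar>" "lam \<le> exp \<bar>ln lam\<bar>" "1 / lam \<le> exp \<bar>ln lam\<bar>"
proof -
  have "exp (ln lam) \<le> exp \<bar>ln lam\<bar>" "exp (- ln lam) \<le> exp \<bar>ln lam\<bar>" by simp_all
  then show "lam \<le> exp \<bar>ln lam\<bar>" "1 / lam \<le> exp \<bar>ln lam\<bar>"
    using assms by (auto simp: exp_minus inverse_eq_divide)
qed simp

lemma mixing_time_le: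
  assumes "indep_sets_of G \<noteq> {}" "finite (indep_sets_of G)"
    and "\<And>I. I \<in> indep_sets_of G \<Longrightarrow>
       tv_dist (indep_sets_of G) (pmf (glauber_dist G lam I t)) (hardcore G lam) \<le> 1 / 4"
  shows "mixing_time G lam \<le> enat t"
proof -
  have "(MAX I \<in> indep_sets_of G.
      tv_dist (indep_sets_of G) (pmf (glauber_dist G lam I t)) (hardcore G lam)) \<le> 1 / 4"
    using assms by (intro Max.boundedI) auto
  then show ?thesis unfolding mixing_time_def by (intro INF_lower) auto
qed

lemma mixing_time_poincare:
  assumes "lam > 0" "finite W" "W \<noteq> {}" "\<gamma> \<ge> 1/2" "C \<ge> 0"
  defines "L \<equiv> 2 * exp \<bar>ln lam\<bar>"
  assumes p: "poincare E lam W (L powr (C * card W powr \<gamma>))"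
  shows "ereal_of_enat (mixing_time (W, E) lam) \<le> ereal (L powr ((C + 12) * card W powr \<gamma>))"
proof -
  let ?n = "card W" and ?\<Omega> = "indep_sets_of (W, E)" and ?Z = "hardcore_Z (W, E) lam"
  define T where "T = L powr (C * ?n powr \<gamma>)"
  define x where "x = ?n powr \<gamma>"
  note f = fugacity_bounds[OF assms(1)]
  have L: "L \<ge> 2" "1 + lam \<le> L" "1 / lam \<le> L" using f unfolding L_def by linarith+
  have n: "?n \<ge> 1" using assms by (simp add: Suc_leI card_gt_0_iff)
  have x1: "x \<ge> 1" unfolding x_def using n assms by (intro ge_one_powr_ge_zero) auto
  have T: "T > 0" unfolding T_def using L by simp
  \<comment> \<open>Chosen so that the decay rate times \<open>R\<close> equals
    \<open>2 * (?n + 1) * ln L\<close>: the quantity to be beaten is at most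
    \<open>L ^ (2 * (?n + 1))\<close>, since \<open>4 \<le> L ^ 2\<close> and both \<open>?Z\<close>
    and \<open>1 / lam ^ card I\<close> are at most \<open>L ^ ?n\<close>.\<close>
  define R where "R = (?n + 1) * ln L * (T * ?n * (lam + 1))"
  define t where "t = nat \<lceil>R\<rceil>"
  have lnL: "0 \<le> ln L" "ln L \<le> L" using L ln_bound[of L] by auto
  have R0: "R \<ge> 0" unfolding R_def using T assms lnL by simp
  have tR: "R \<le> real t" "real t \<le> R + 1" using R0 by (auto simp: t_def)
  have "tv_dist ?\<Omega> (pmf (glauber_dist (W, E) lam I t)) (hardcore (W, E) lam) \<le> 1 / 4" if I: "I \<in> ?\<Omega>" for I
  proof (rule glauber_tv_le[OF assms(1-3) p[folded T_def] T I])
    have "card I \<le> ?n" using I assms by (intro card_mono) (auto simp: indep_iff)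
    have "1 / lam ^ card I = (1 / lam) ^ card I" by (simp add: power_one_over)
    also have "\<dots> \<le> L ^ card I" using L assms by (intro power_mono) auto
    also have "\<dots> \<le> L ^ ?n" using L \<open>card I \<le> ?n\<close> by (intro power_increasing) auto
    finally have 1: "1 / lam ^ card I \<le> L ^ ?n" .
    have "?Z \<le> (1 + lam) ^ ?n" using hardcore_Z_le_power assms by blast
    also have "\<dots> \<le> L ^ ?n" using L assms by (intro power_mono) auto
    finally have 2: "?Z \<le> L ^ ?n" .
    have "(2::real) ^ 2 \<le> L ^ 2" using L by (intro power_mono) auto
    then have 3: "4 \<le> L ^ 2" by simp
    have "4 * ?Z * (1 / lam ^ card I) \<le> L ^ 2 * L ^ ?n * L ^ ?n"
      using 1 2 3 L assms hardcore_Z_ge_1[of W lam E] by (intro mult_mono) auto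
    also have "\<dots> = L ^ (2 * (?n + 1))"
      by (simp only: power_add[symmetric]) (simp add: mult_2)
    also have "\<dots> = exp (real (2 * (?n + 1)) * ln L)"
      using L by (subst exp_of_nat_mult) simp
    also have "\<dots> = exp (2 / (T * ?n * (lam + 1)) * R)"
    proof -
      define d where "d = T * ?n * (lam + 1)"
      have "d > 0" unfolding d_def using T n assms(1) by simp
      then have "2 / d * ((?n + 1) * ln L * d) = real (2 * (?n + 1)) * ln L" by simp
      then show ?thesis by (simp add: R_def d_def)
    qed
    also have "\<dots> \<le> exp (2 / (T * ?n * (lam + 1)) * real t)"
      using tR(1) T n assms(1) by (simp add: divide_right_mono)
    finally show "4 * ?Z / lam ^ card I \<le> exp (2 / (T * ?n * (lam + 1)) * real t)" by simp
  qed
  moreover have "?\<Omega> \<noteq> {}" using empty_indep[of W E] by blast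
  ultimately have "mixing_time (W, E) lam \<le> enat t"
    using assms(2) by (intro mixing_time_le) auto
  then have "ereal_of_enat (mixing_time (W, E) lam) \<le> ereal_of_enat (enat t)"
    by (simp only: ereal_of_enat_le_iff)
  also have "\<dots> = ereal (real t)" by simp
  also have "real t \<le> L powr ((C + 12) * x)"
  proof -
    \<comment> \<open>The 12 splits into \<open>1 + 4\<close> for \<open>?n + 1\<close>, 1 for
      \<open>ln L\<close>, 4 for \<open>?n\<close>, 1 for \<open>lam + 1\<close>, and 1 for rounding
      \<open>R\<close> up.\<close>
    have n4: "real ?n \<le> L powr (4 * x)" unfolding x_def by (rule of_nat_le_powr[OF n L(1) assms(4)])
    have "real (?n + 1) \<le> 2 * real ?n" using n by simp
    also have "\<dots> \<le> L * L powr (4 * x)" using n4 L by (intro mult_mono) auto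
    finally have a: "real (?n + 1) \<le> L * L powr (4 * x)" .
    have "R \<le> (L * L powr (4 * x)) * L * (L powr (C * x) * L powr (4 * x) * L)"
      unfolding R_def T_def x_def[symmetric]
      using a n4 lnL L assms by (intro mult_mono) auto
    also have "\<dots> = (L powr 1 * L powr (4 * x)) * L powr 1 * (L powr (C * x) * L powr (4 * x) * L powr 1)"
      using L by simp
    also have "\<dots> = L powr (3 + 8 * x + C * x)"
      by (simp only: powr_add[symmetric]) (simp add: algebra_simps)
    also have "\<dots> \<le> L powr (11 * x + C * x)" using x1 L by (intro powr_mono) auto
    finally have R: "R \<le> L powr (11 * x + C * x)" .
    have "1 \<le> L powr (11 * x + C * x)" using x1 L assms by (intro ge_one_powr_ge_zero) auto
    then have "real t \<le> 2 * L powr (11 * x + C * x)" using R tR by linarith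
    also have "\<dots> \<le> L powr x * L powr (11 * x + C * x)"
    proof (rule mult_right_mono)
      have "L powr 1 \<le> L powr x" using x1 L by (intro powr_mono) auto
      then show "2 \<le> L powr x" using L by simp
    qed simp
    also have "\<dots> = L powr ((C + 12) * x)" by (simp add: powr_add[symmetric] algebra_simps)
    finally show ?thesis .
  qed
  finally show ?thesis by (simp add: x_def)
qed

text \<open>With \<open>l = exp \<bar>ln lam\<bar>\<close>, a clique has partition function at most
  \<open>l * (1 + card C)\<close>. Since \<open>C\<close> is nonempty,
  \<open>log 2 (1 + card C) \<ge> 1\<close>, so \<open>l\<close> too may be raised to this
  power.\<close>

lemma clique_union_Z_le:
  fixes lam :: real
  assumes "lam > 0" "finite F" "\<And>C. C \<in> F \<Longrightarrow> finite C \<and> C \<noteq> {}"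
    and "\<And>C u v. C \<in> F \<Longrightarrow> u \<in> C \<Longrightarrow> v \<in> C \<Longrightarrow> u \<noteq> v \<Longrightarrow> {u, v} \<in> E"
  shows "hardcore_Z (\<Union>F, E) lam \<le> (2 * exp \<bar>ln lam\<bar>) powr (\<Sum>C\<in>F. log 2 (1 + real (card C)))"
proof -
  define l where "l = exp \<bar>ln lam\<bar>"
  note f = fugacity_bounds[OF assms(1), folded l_def]
  have "hardcore_Z (\<Union>F, E) lam \<le> (\<Prod>C\<in>F. hardcore_Z (C, E) lam)"
    using assms by (intro hardcore_Z_Union_le) auto
  also have "\<dots> \<le> (\<Prod>C\<in>F. (2 * l) powr log 2 (1 + real (card C)))"
  proof (intro prod_mono conjI)
    fix C assume C: "C \<in> F"
    show "0 \<le> hardcore_Z (C, E) lam" using hardcore_Z_ge_1[of C lam E] assms C by auto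
    have c1: "card C \<ge> 1" using assms(3)[OF C] by (simp add: Suc_leI card_gt_0_iff)
    have "hardcore_Z (C, E) lam \<le> 1 + lam * card C"
      using assms C by (intro hardcore_Z_clique_le) auto
    also have "\<dots> \<le> l + l * card C" using f by (intro add_mono mult_right_mono) auto
    also have "\<dots> = 2 powr log 2 (1 + real (card C)) * l" by (simp add: algebra_simps)
    also have "\<dots> \<le> 2 powr log 2 (1 + real (card C)) * l powr log 2 (1 + real (card C))"
    proof (rule mult_left_mono)
      have "1 \<le> log 2 (1 + real (card C))" using c1 by simp
      then have "l powr 1 \<le> l powr log 2 (1 + real (card C))" using f by (intro powr_mono) auto
      then show "l \<le> l powr log 2 (1 + real (card C))" using f by simp
    qed simp
    also have "\<dots> = (2 * l) powr log 2 (1 + real (card C))" using f by (simp add: powr_mult)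
    finally show "hardcore_Z (C, E) lam \<le> (2 * l) powr log 2 (1 + real (card C))" .
  qed
  also have "\<dots> = (2 * l) powr (\<Sum>C\<in>F. log 2 (1 + real (card C)))"
    using f assms(2) by (subst powr_sum) auto
  finally show ?thesis by (simp add: l_def)
qed

section \<open>Clique separators for families of balls\<close>

definition cell :: "real ^ 'd \<Rightarrow> real \<Rightarrow> real ^ 'd \<Rightarrow> 'd \<Rightarrow> int" where
  "cell x h p = (\<lambda>k. \<lfloor>(p $ k - x $ k) / h\<rfloor>)"

text \<open>The factor \<open>CARD('d)\<close> comes from bounding the Euclidean norm by the sum of
  the coordinates.\<close>

lemma dist_same_cell:
  fixes p q :: "real ^ 'd" and h :: real
  assumes "h > 0" "cell x h p = cell x h q"
  shows "dist p q < CARD('d) * h"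
proof -
  have "\<bar>(p - q) $ k\<bar> < h" for k
  proof -
    have "\<lfloor>(p $ k - x $ k) / h\<rfloor> = \<lfloor>(q $ k - x $ k) / h\<rfloor>"
      using fun_cong[OF assms(2), of k] by (simp add: cell_def)
    then have "\<bar>(p $ k - x $ k) / h - (q $ k - x $ k) / h\<bar> < 1" by linarith
    then have "\<bar>(p $ k - q $ k) / h\<bar> < 1" by (simp add: diff_divide_distrib)
    then show ?thesis using assms(1) by (simp add: abs_divide pos_divide_less_eq)
  qed
  then have "(\<Sum>k\<in>UNIV. \<bar>(p - q) $ k\<bar>) < (\<Sum>k\<in>(UNIV :: 'd set). h)"
    by (intro sum_strict_mono) auto
  then show ?thesis
    using norm_le_l1_cart[of "p - q"] by (simp add: dist_norm)
qed

lemma card_cells_le: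
  fixes x :: "real ^ 'd" and h :: real
  assumes "h > 0" "\<And>p. p \<in> P \<Longrightarrow> dist p x \<le> real q * h"
  shows "finite (cell x h ` P)" "card (cell x h ` P) \<le> (2 * q + 1) ^ CARD('d)"
proof -
  let ?B = "PiE (UNIV :: 'd set) (\<lambda>_. {- int q..int q})"
  have "cell x h p \<in> ?B" if "p \<in> P" for p
  proof -
    have "- int q \<le> \<lfloor>(p $ k - x $ k) / h\<rfloor> \<and> \<lfloor>(p $ k - x $ k) / h\<rfloor> \<le> int q" for k
    proof -
      have "\<bar>p $ k - x $ k\<bar> \<le> real q * h"
        using component_le_norm_cart[of "p - x" k] assms(2)[OF that] by (simp add: dist_norm)
      then have "\<bar>(p $ k - x $ k) / h\<bar> \<le> real q"
        using assms(1) by (simp add: abs_divide pos_divide_le_eq)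
      then show ?thesis by linarith
    qed
    then show ?thesis by (simp add: cell_def PiE_iff)
  qed
  then have sub: "cell x h ` P \<subseteq> ?B" by blast
  have fin: "finite ?B" by (intro finite_PiE) auto
  show "finite (cell x h ` P)" using sub fin finite_subset by blast
  have "card (cell x h ` P) \<le> card ?B" using sub fin by (rule card_mono[rotated])
  also have "\<dots> = (2 * q + 1) ^ CARD('d)"
  proof -
    have "nat (2 * int q + 1) = 2 * q + 1" by linarith
    then show ?thesis by (subst card_PiE) auto
  qed
  finally show "card (cell x h ` P) \<le> (2 * q + 1) ^ CARD('d)" .
qed

lemma card_le_fibres:
  assumes "finite P" "\<And>y. y \<in> f ` P \<Longrightarrow> card {k\<in>P. f k = y} \<le> m"
  shows "card P \<le> card (f ` P) * m"
proof -
  have "card P = (\<Sum>y\<in>f ` P. \<Sum>k | k \<in> P \<and> f k = y. 1)"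
    using sum.image_gen[OF assms(1), of "\<lambda>_. 1::nat" f] by simp
  also have "\<dots> \<le> (\<Sum>y\<in>f ` P. m)" using assms(2) by (intro sum_mono) simp
  finally show ?thesis by simp
qed

text \<open>Points in one cell of side \<open>s / CARD('d)\<close> are closer than \<open>s\<close>,
  so a cell holds at most \<open>m\<close> centres; the radius \<open>2 * s\<close> is
  \<open>2 * CARD('d)\<close> sides, which bounds the number of cells.\<close>

lemma doubling_count:
  fixes c :: "'v \<Rightarrow> real ^ 'd"
  assumes "finite W" "s > 0" "\<And>i. i \<in> W \<Longrightarrow> card {k\<in>W. dist (c i) (c k) < s} \<le> m"
  shows "card {k\<in>W. dist (c k) x \<le> 2 * s} \<le> (4 * CARD('d) + 1) ^ CARD('d) * m"
proof -
  let ?d = "CARD('d)"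
  define h where "h = s / ?d"
  have h: "h > 0" "?d * h = s" using assms(2) by (auto simp: h_def)
  let ?P = "{k\<in>W. dist (c k) x \<le> 2 * s}"
  let ?f = "\<lambda>k. cell x h (c k)"
  have "card ?P \<le> card (?f ` ?P) * m"
  proof (rule card_le_fibres)
    fix y assume "y \<in> ?f ` ?P"
    then obtain i where i: "i \<in> W" "y = ?f i" by blast
    have "{k \<in> ?P. ?f k = y} \<subseteq> {k\<in>W. dist (c i) (c k) < s}"
      using dist_same_cell[OF h(1)] i h(2) by (auto simp: dist_commute)
    then have "card {k \<in> ?P. ?f k = y} \<le> card {k\<in>W. dist (c i) (c k) < s}"
      using assms(1) by (intro card_mono) auto
    also have "\<dots> \<le> m" using assms(3) i by blast
    finally show "card {k \<in> ?P. ?f k = y} \<le> m" .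
  qed (use assms in auto)
  also have "card (?f ` ?P) = card (cell x h ` c ` ?P)" by (simp add: image_image)
  also have "\<dots> \<le> (2 * (2 * ?d) + 1) ^ ?d"
    using h by (intro card_cells_le) (auto simp: mult.assoc)
  finally show ?thesis by simp
qed

text \<open>The radius is the least distance between centres at which some centre sees at least
  \<open>m\<close> of them; minimality makes every open ball of this radius sparse.\<close>

lemma ex_densest_ball:
  fixes c :: "'v \<Rightarrow> 'a::metric_space"
  assumes "finite W" "1 \<le> m" "m \<le> card W"
  shows "\<exists>i\<in>W. \<exists>s\<ge>0. m \<le> card {k\<in>W. dist (c i) (c k) \<le> s}
     \<and> (\<forall>j\<in>W. card {k\<in>W. dist (c j) (c k) < s} < m)"
proof -
  define D where "D = {t \<in> (\<lambda>(i, j). dist (c i) (c j)) ` (W \<times> W). \<exists>i\<in>W. m \<le> card {k\<in>W. dist (c i) (c k) \<le> t}}"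
  have finD: "finite D" using assms by (simp add: D_def)
  \<comment> \<open>Any \<open>m\<close> indices lie within the distance to the farthest of them, so
    a successful radius may be shrunk to an attained distance, an element of the finite set
    \<open>D\<close>.\<close>
  have key: "\<exists>t\<in>D. \<exists>k\<in>F. t = dist (c i) (c k)" if i: "i \<in> W" and F: "F \<subseteq> W" "m \<le> card F" for i F
  proof -
    have finF: "finite F" using F assms finite_subset by blast
    have Fne: "F \<noteq> {}" using F assms by auto
    have "Max ((\<lambda>k. dist (c i) (c k)) ` F) \<in> (\<lambda>k. dist (c i) (c k)) ` F"
      using finF Fne by (intro Max_in) auto
    then obtain k where k: "k \<in> F" "Max ((\<lambda>k. dist (c i) (c k)) ` F) = dist (c i) (c k)" by blast
    have "F \<subseteq> {l\<in>W. dist (c i) (c l) \<le> dist (c i) (c k)}"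
      using F finF k(2)[symmetric] by auto
    then have "m \<le> card {l\<in>W. dist (c i) (c l) \<le> dist (c i) (c k)}"
      using assms(1) by (intro order_trans[OF F(2) card_mono]) auto
    then have "dist (c i) (c k) \<in> D" using i k F by (auto simp: D_def)
    then show ?thesis using k by blast
  qed
  have "W \<noteq> {}" using assms by auto
  then have "D \<noteq> {}" using key[of _ W] assms by blast
  then have "Min D \<in> D" using finD by simp
  then obtain i where i: "i \<in> W" "m \<le> card {k\<in>W. dist (c i) (c k) \<le> Min D}" "Min D \<ge> 0"
    by (auto simp: D_def)
  have "card {k\<in>W. dist (c j) (c k) < Min D} < m" if j: "j \<in> W" for j
  proof (rule ccontr)
    assume "\<not> ?thesis"
    then obtain t k where "t \<in> D" "t = dist (c j) (c k)" "dist (c j) (c k) < Min D"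
      using key[OF j, of "{k\<in>W. dist (c j) (c k) < Min D}"] by auto
    then show False using finD by (meson Min_le leD)
  qed
  then show ?thesis using i by blast
qed

text \<open>If \<open>x\<close> lies within \<open>r - \<rho>\<close> of \<open>p\<close>, take
  \<open>y = x\<close>; otherwise \<open>y\<close> is the point of the segment from \<open>p\<close>
  to \<open>x\<close> at distance \<open>r - \<rho>\<close> from \<open>p\<close>.\<close>

lemma ball_shrink:
  fixes p x :: "'a::real_normed_vector"
  assumes "0 < \<rho>" "\<rho> \<le> r" "dist p x \<le> r + t" "t \<ge> 0"
  shows "\<exists>y. ball y \<rho> \<subseteq> ball p r \<and> dist y x \<le> t + \<rho>"
proof (cases "dist p x \<le> r - \<rho>")
  case True
  have "ball x \<rho> \<subseteq> ball p r"
  proof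
    fix z assume "z \<in> ball x \<rho>"
    then show "z \<in> ball p r" using True dist_triangle[of p z x] by simp
  qed
  then show ?thesis using assms by (intro exI[of _ x]) auto
next
  case False
  define u where "u = (r - \<rho>) / norm (x - p)"
  define y where "y = p + u *\<^sub>R (x - p)"
  have D: "dist p x = norm (x - p)" by (simp add: dist_norm norm_minus_commute)
  have D0: "norm (x - p) > 0" using False assms D by linarith
  have u: "0 \<le> u" "u \<le> 1" using False assms D D0 by (auto simp: u_def)
  have "dist p y = u * norm (x - p)" using u by (simp add: y_def dist_norm)
  then have py: "dist p y = r - \<rho>" using D0 by (simp add: u_def)
  have "y - x = (u - 1) *\<^sub>R (x - p)" by (simp add: y_def algebra_simps)
  then have "dist y x = (1 - u) * norm (x - p)" using u by (simp add: dist_norm)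
  also have "\<dots> = norm (x - p) - (r - \<rho>)" 
  proof -
    have "u * norm (x - p) = r - \<rho>" using D0 by (simp add: u_def)
    then show ?thesis by (simp add: left_diff_distrib)
  qed
  finally have yx: "dist y x \<le> t + \<rho>" using assms D by simp
  have "ball y \<rho> \<subseteq> ball p r"
  proof
    fix z assume "z \<in> ball y \<rho>"
    then show "z \<in> ball p r" using py dist_triangle[of p z y] by simp
  qed
  then show ?thesis using yx by blast
qed

section \<open>Elementary estimates and averaging over concentric spheres\<close>

lemma card_nat_interval_le:
  fixes a b :: real
  assumes "b \<ge> 0" "\<And>k. k \<in> S \<Longrightarrow> \<bar>real k - a\<bar> \<le> b"
  shows "card S \<le> 2 * b + 1"
proof -
  have sub: "int ` S \<subseteq> {\<lceil>a - b\<rceil>..\<lfloor>a + b\<rfloor>}"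
  proof
    fix z assume "z \<in> int ` S"
    then obtain k where "z = int k" "\<bar>real k - a\<bar> \<le> b" using assms(2) by blast
    then show "z \<in> {\<lceil>a - b\<rceil>..\<lfloor>a + b\<rfloor>}"
      by (auto simp: ceiling_le_iff le_floor_iff)
  qed
  have "card S = card (int ` S)" by (simp add: card_image)
  also have "\<dots> \<le> card {\<lceil>a - b\<rceil>..\<lfloor>a + b\<rfloor>}" using sub by (intro card_mono) auto
  also have "\<dots> = nat (\<lfloor>a + b\<rfloor> - \<lceil>a - b\<rceil> + 1)" by simp
  finally have "card S \<le> nat (\<lfloor>a + b\<rfloor> - \<lceil>a - b\<rceil> + 1)" .
  then show ?thesis using assms(1) by linarith
qed

text \<open>The closed form suits the induction; dropping the subtracted term, for nonnegative
  \<open>d\<close>, leaves a bound independent of \<open>J\<close>.\<close>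

lemma sum_geometric_linear:
  fixes d :: real
  shows "(\<Sum>i\<le>J. (1 + real i * d) / 2 ^ i) = 2 + 2 * d - (1 + d * (real J + 2)) / 2 ^ J"
  by (induction J) (simp_all add: field_simps)

text \<open>A bound linear in \<open>m\<close>: summed over classes it involves only their number
  and total size. It is useful when \<open>2 ^ a\<close> is about the average class size.\<close>

lemma log_le_threshold:
  fixes a m :: nat
  shows "log 2 (1 + real m) \<le> 1 + real a + 2 * real m / 2 ^ a"
proof -
  have "1 + real m \<le> (2 * 2 ^ a) * (1 + real m / 2 ^ a)"
  proof -
    have "(2 * 2 ^ a) * (1 + real m / 2 ^ a) = 2 * 2 ^ a + 2 * real m" by (simp add: field_simps)
    moreover have "(1::real) \<le> 2 ^ a" by simp
    ultimately show ?thesis by linarith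
  qed
  then have "log 2 (1 + real m) \<le> log 2 ((2 * 2 ^ a) * (1 + real m / 2 ^ a))"
    by (subst log_le_cancel_iff) (auto intro: add_pos_nonneg mult_pos_pos)
  also have "\<dots> = log 2 (2 * 2 ^ a) + log 2 (1 + real m / 2 ^ a)"
  proof (rule log_mult_pos)
    show "0 < 1 + real m / 2 ^ a" by (intro add_pos_nonneg) auto
  qed simp
  also have "log 2 (2 * 2 ^ a) = 1 + real a"
    by (simp add: log_mult log_nat_power)
  also have "log 2 (1 + real m / 2 ^ a) \<le> 2 * real m / 2 ^ a"
  proof -
    let ?y = "real m / 2 ^ a"
    have "ln (1 + ?y) \<le> ?y" by (rule ln_add_one_self_le_self) simp
    also have "\<dots> \<le> 2 * ?y * ln 2"
      using ln2_ge_two_thirds mult_left_mono[of "1/2" "ln 2" "2 * ?y"] by simp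
    finally show ?thesis by (simp add: log_def pos_divide_le_eq)
  qed
  finally show ?thesis by simp
qed

text \<open>\<open>J\<close> is about \<open>log 2 n / d\<close>, so that there will be about
  \<open>n powr (1 / d)\<close> spheres; adding 1 after rounding down gives both
  \<open>J \<ge> 1\<close> and \<open>n \<le> 2 ^ (J * d)\<close>.\<close>

lemma dyadic_exponent:
  assumes "n \<ge> 1" "d \<ge> (1::nat)"
  shows "\<exists>J\<ge>1. real n \<le> 2 ^ (J * d) \<and> 2 ^ J \<le> 2 * real n powr (1 / d)"
proof -
  define u where "u = log 2 (real n) / d"
  define J where "J = nat \<lfloor>u\<rfloor> + 1"
  have u: "u \<ge> 0" using assms by (simp add: u_def)
  have J: "real J \<le> u + 1" "u \<le> real J" using u by (auto simp: J_def) linarith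
  have "real n = 2 powr (u * d)" using assms by (simp add: u_def)
  also have "\<dots> \<le> 2 powr (real (J * d))" using J assms by (intro powr_mono) (auto intro: mult_right_mono)
  finally have 1: "real n \<le> 2 ^ (J * d)" by (subst (asm) powr_realpow) auto
  have "2 ^ J = 2 powr real J" by (simp add: powr_realpow)
  also have "\<dots> \<le> 2 powr (u + 1)" using J by (intro powr_mono) auto
  also have "\<dots> = 2 * (2 powr log 2 (real n)) powr (1 / d)" by (simp add: powr_add powr_powr u_def)
  finally have 2: "2 ^ J \<le> 2 * real n powr (1 / d)" using assms by simp
  show ?thesis using 1 2 by (intro exI[of _ J]) (auto simp: J_def)
qed

text \<open>The averaging step: \<open>key\<close> assigns to every ball a level and a cell, and \<open>R i k\<close> says that the
  ball \<open>i\<close> meets the \<open>k\<close>-th sphere.  The sum over the levels is geometric, dominated by the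
  smallest balls, because \<open>d \<ge> 2\<close>.\<close>

lemma ex_light_index:
  fixes key :: "'v \<Rightarrow> nat \<times> 'k" and \<omega> :: "nat \<times> 'k \<Rightarrow> real" and d J :: nat
  assumes "finite U" "finite Ks" "card Ks = 2 ^ J" "d \<ge> 2" "K \<ge> 0" "\<And>\<kappa>. \<omega> \<kappa> \<ge> 0"
    and lev: "\<And>i. i \<in> U \<Longrightarrow> fst (key i) \<le> J"
    and hits: "\<And>i. i \<in> U \<Longrightarrow> real (card {k\<in>Ks. \<exists>j\<in>U. key j = key i \<and> R j k}) \<le> 4 * 2 ^ (J - fst (key i))"
    and weight: "\<And>l. l \<le> J \<Longrightarrow> (\<Sum>\<kappa> | \<kappa> \<in> key ` U \<and> fst \<kappa> = l. \<omega> \<kappa>) \<le> K * 2 ^ (l * d) * (1 + real (J - l) * d)"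
  shows "\<exists>k\<in>Ks. (\<Sum>\<kappa>\<in>key ` {i\<in>U. R i k}. \<omega> \<kappa>) \<le> 8 * K * (1 + d) * 2 ^ (J * (d - 1))"
proof (rule ccontr)
  let ?B = "8 * K * (1 + d) * 2 ^ (J * (d - 1))"
  let ?S = "\<lambda>k. \<Sum>\<kappa>\<in>key ` {i\<in>U. R i k}. \<omega> \<kappa>"
  assume "\<not> (\<exists>k\<in>Ks. ?S k \<le> ?B)"
  then have gt: "?S k > ?B" if "k \<in> Ks" for k using that by (simp add: not_le)
  have "Ks \<noteq> {}" using assms(3) by auto
  then have "(\<Sum>k\<in>Ks. ?B) < (\<Sum>k\<in>Ks. ?S k)" using gt assms(2) by (intro sum_strict_mono) auto
  then have lower: "2 ^ J * ?B < (\<Sum>k\<in>Ks. ?S k)" using assms(3) by simp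
  have "(\<Sum>k\<in>Ks. ?S k) = (\<Sum>k\<in>Ks. \<Sum>\<kappa>\<in>key ` U. if \<exists>j\<in>U. key j = \<kappa> \<and> R j k then \<omega> \<kappa> else 0)"
  proof (intro sum.cong[of Ks, OF refl])
    fix k
    have "(\<exists>j\<in>U. key j = \<kappa> \<and> R j k) \<longleftrightarrow> \<kappa> \<in> key ` {i\<in>U. R i k}" for \<kappa> by blast
    then show "?S k = (\<Sum>\<kappa>\<in>key ` U. if \<exists>j\<in>U. key j = \<kappa> \<and> R j k then \<omega> \<kappa> else 0)"
      using assms(1) by (simp only:) (intro sum.mono_neutral_cong_left, auto)
  qed
  \<comment> \<open>Counted by classes instead of spheres, each class contributes its weight once
    for every sphere that meets one of its members.\<close>
  also have "\<dots> = (\<Sum>\<kappa>\<in>key ` U. \<Sum>k\<in>Ks. if \<exists>j\<in>U. key j = \<kappa> \<and> R j k then \<omega> \<kappa> else 0)"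
    by (rule sum.swap)
  also have "\<dots> = (\<Sum>\<kappa>\<in>key ` U. \<omega> \<kappa> * card {k\<in>Ks. \<exists>j\<in>U. key j = \<kappa> \<and> R j k})"
    using assms(2) by (intro sum.cong refl) (simp add: sum.If_cases Int_def)
  also have "\<dots> \<le> (\<Sum>\<kappa>\<in>key ` U. \<omega> \<kappa> * (4 * 2 ^ (J - fst \<kappa>)))"
    using hits assms(6) by (intro sum_mono mult_left_mono) auto
  also have "\<dots> = (\<Sum>l\<le>J. \<Sum>\<kappa> | \<kappa> \<in> key ` U \<and> fst \<kappa> = l. \<omega> \<kappa> * (4 * 2 ^ (J - fst \<kappa>)))"
    using assms(1) lev by (intro sum.group[symmetric]) auto
  also have "\<dots> = (\<Sum>l\<le>J. (\<Sum>\<kappa> | \<kappa> \<in> key ` U \<and> fst \<kappa> = l. \<omega> \<kappa>) * (4 * 2 ^ (J - l)))"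
    unfolding sum_distrib_right by (intro sum.cong refl) simp
  also have "\<dots> \<le> (\<Sum>l\<le>J. K * 2 ^ (l * d) * (1 + real (J - l) * d) * (4 * 2 ^ (J - l)))"
    using weight by (intro sum_mono mult_right_mono) auto
  also have "\<dots> = (\<Sum>i\<le>J. K * 2 ^ ((J - i) * d) * (1 + real i * d) * (4 * 2 ^ i))"
    by (rule sum.reindex_bij_witness[of _ "\<lambda>i. J - i" "\<lambda>i. J - i"]) auto
  also have "\<dots> \<le> (\<Sum>i\<le>J. 4 * K * 2 ^ (J * d) * ((1 + real i * d) / 2 ^ i))"
  proof (rule sum_mono)
    fix i assume "i \<in> {..J}"
    then have "i \<le> J" by simp
    \<comment> \<open>Here \<open>d \<ge> 2\<close> enters: the cell count falls by
      \<open>2 ^ d\<close> per level towards larger balls while the number of spheres met only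
      doubles, leaving a factor \<open>1 / 2 ^ i\<close>.\<close>
    have "(J - i) * d + 2 * i \<le> (J - i) * d + d * i" using assms(4) by simp
    also have "\<dots> = (J - i + i) * d" by (simp only: add_mult_distrib2 mult.commute)
    also have "\<dots> = J * d" using \<open>i \<le> J\<close> by simp
    finally have "(2::real) ^ ((J - i) * d + 2 * i) \<le> 2 ^ (J * d)" by (intro power_increasing) auto
    then have "(2::real) ^ ((J - i) * d) * 2 ^ i \<le> 2 ^ (J * d) / 2 ^ i"
      by (simp add: power_add power_mult power2_eq_square mult_2 pos_le_divide_eq mult.assoc)
    then have "4 * K * (1 + real i * d) * ((2::real) ^ ((J - i) * d) * 2 ^ i) \<le> 4 * K * (1 + real i * d) * (2 ^ (J * d) / 2 ^ i)"
      using assms(5) by (intro mult_left_mono) auto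
    then show "K * 2 ^ ((J - i) * d) * (1 + real i * d) * (4 * 2 ^ i) \<le> 4 * K * 2 ^ (J * d) * ((1 + real i * d) / 2 ^ i)"
      by (simp only: mult_ac times_divide_eq_right times_divide_eq_left)
  qed
  also have "\<dots> = 4 * K * 2 ^ (J * d) * (\<Sum>i\<le>J. (1 + real i * d) / 2 ^ i)"
    by (simp only: sum_distrib_left)
  also have "\<dots> \<le> 4 * K * 2 ^ (J * d) * (2 + 2 * d)"
    using assms(5) unfolding sum_geometric_linear by (intro mult_left_mono) auto
  also have "\<dots> = 2 ^ J * ?B"
  proof -
    obtain e where "d = Suc e" using assms(4) by (cases d) auto
    then show ?thesis by (simp add: power_add algebra_simps)
  qed
  finally show False using lower by simp
qed

text \<open>The members of \<open>F\<close> are classes of balls of equal level and grid cell, and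
  \<open>k\<close> comes from averaging over \<open>2 ^ J\<close> radii. In \<open>K\<close>, the
  power of \<open>13 * CARD('d)\<close> counts cells and the summand 2 pays for the part of
  \<open>log_le_threshold\<close> that is linear in the class sizes.\<close>

lemma light_sphere:
  fixes c :: "'v \<Rightarrow> real ^ 'd" and s\<^sub>0 :: real
  assumes "finite W" and r: "\<And>i. i \<in> W \<Longrightarrow> r i > 0" and d: "CARD('d) \<ge> 2" and s: "s\<^sub>0 > 0" and J: "J \<ge> 1"
    and card: "real (card W) \<le> 2 ^ (J * CARD('d))"
  defines "K \<equiv> (13 * real CARD('d)) ^ CARD('d) + 2"
  shows "\<exists>k\<in>{1..2 ^ J}. \<exists>F. finite F \<and> (\<forall>C\<in>F. C \<noteq> {} \<and> C \<subseteq> W \<and>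
       (\<forall>i\<in>C. \<forall>j\<in>C. ball (c i) (r i) \<inter> ball (c j) (r j) \<noteq> {})) \<and>
     {i\<in>W. \<bar>dist (c i) x - s\<^sub>0 * (1 + real k / 2 ^ J)\<bar> \<le> r i} \<subseteq> \<Union>F \<and>
     (\<Sum>C\<in>F. log 2 (1 + real (card C))) \<le> 8 * K * (1 + CARD('d)) * 2 ^ (J * (CARD('d) - 1))"
proof -
  let ?d = "CARD('d)"
  have d0: "real ?d > 0" using d by simp
  define R where "R = (\<lambda>i (k::nat). \<bar>dist (c i) x - s\<^sub>0 * (1 + real k / 2 ^ J)\<bar> \<le> r i)"
  define U where "U = {i\<in>W. \<exists>k\<in>{1..2 ^ J}. R i k}"
  have UW: "U \<subseteq> W" and finU: "finite U" using assms(1) by (auto simp: U_def)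
  have reach: "dist (c i) x \<le> r i + 2 * s\<^sub>0" if "i \<in> U" for i
  proof -
    obtain k where k: "k \<in> {1..2 ^ J}" "R i k" using \<open>i \<in> U\<close> by (auto simp: U_def)
    have "real k \<le> real (2 ^ J)" using k by (subst of_nat_le_iff) simp
    then have "1 + real k / 2 ^ J \<le> 2" by simp
    then have "s\<^sub>0 * (1 + real k / 2 ^ J) \<le> s\<^sub>0 * 2" using s by (intro mult_left_mono) auto
    then show ?thesis using k(2) by (simp add: R_def)
  qed
  \<comment> \<open>Level \<open>l\<close> contains the radii between \<open>s\<^sub>0 / 2 ^ (l + 1)\<close> and \<open>s\<^sub>0 / 2 ^ l\<close>, except that all larger
    balls are put in level 0 and all smaller ones in level \<open>J\<close>, where every ball is a class of its own.\<close>
  define lev where "lev = (\<lambda>i. LEAST l. l = J \<or> s\<^sub>0 / 2 ^ Suc l \<le> r i)"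
  have levP: "lev i = J \<or> s\<^sub>0 / 2 ^ Suc (lev i) \<le> r i" for i
    unfolding lev_def by (rule LeastI[of _ J]) simp
  have lev_le: "lev i \<le> J" for i unfolding lev_def by (rule Least_le) simp
  have lev_small: "r i < s\<^sub>0 / 2 ^ lev i" if "lev i \<ge> 1" for i
  proof -
    have "lev i - 1 < lev i" using that by simp
    then have "\<not> (lev i - 1 = J \<or> s\<^sub>0 / 2 ^ Suc (lev i - 1) \<le> r i)"
      unfolding lev_def by (rule not_less_Least)
    then show ?thesis using that by simp
  qed
  \<comment> \<open>A ball of level 0 may be huge with its centre far away; it is represented by a small ball inside
    it that lies near \<open>x\<close>.\<close>
  have "\<exists>y. ball y (s\<^sub>0 / 2) \<subseteq> ball (c i) (r i) \<and> dist y x \<le> 2 * s\<^sub>0 + s\<^sub>0 / 2" if "i \<in> U" "lev i = 0" for i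
    using levP[of i] that J s reach[OF that(1)] by (intro ball_shrink) auto
  then obtain y0 where y0: "\<And>i. i \<in> U \<Longrightarrow> lev i = 0 \<Longrightarrow>
      ball (y0 i) (s\<^sub>0 / 2) \<subseteq> ball (c i) (r i) \<and> dist (y0 i) x \<le> 2 * s\<^sub>0 + s\<^sub>0 / 2" by metis
  define y where "y = (\<lambda>i. if lev i = 0 then y0 i else c i)"
  \<comment> \<open>With this side, points of one cell are closer than
    \<open>s\<^sub>0 / 2 ^ Suc l\<close>. Below level \<open>J\<close>, a ball of that radius around
    \<open>y i\<close> lies in ball \<open>i\<close>, which therefore contains the points
    \<open>y j\<close> of its class.\<close>
  define h where "h = (\<lambda>l. s\<^sub>0 / 2 ^ Suc l / ?d)"
  have h: "h l > 0" "?d * h l = s\<^sub>0 / 2 ^ Suc l" for l using s d0 by (auto simp: h_def)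
  have y_ball: "ball (y i) (s\<^sub>0 / 2 ^ Suc (lev i)) \<subseteq> ball (c i) (r i)" if "i \<in> U" "lev i < J" for i
  proof (cases "lev i = 0")
    case True
    then show ?thesis using y0 that by (simp add: y_def)
  next
    case False
    then show ?thesis using levP[of i] that by (simp add: y_def subset_ball)
  qed
  have y_dist: "dist (y i) x \<le> 3 * s\<^sub>0" if "i \<in> U" for i
  proof (cases "lev i = 0")
    case True
    then show ?thesis using y0[OF that] s by (simp add: y_def)
  next
    case False
    have "s\<^sub>0 / 2 ^ lev i \<le> s\<^sub>0 / 1" using s by (intro divide_left_mono) auto
    then show ?thesis using reach[OF that] lev_small[of i] False by (simp add: y_def)
  qed
  define key where "key = (\<lambda>i. (lev i, if lev i < J then Inl (cell x (h (lev i)) (y i)) else Inr i))"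
  have fst_key: "fst (key i) = lev i" for i by (simp add: key_def)
  have same_lev: "lev i = lev j" if "key i = key j" for i j using that by (simp add: key_def)
  have same_near: "dist (y i) (y j) < s\<^sub>0 / 2 ^ Suc (lev i)" if "key i = key j" "lev i < J" for i j
  proof -
    have "cell x (h (lev i)) (y i) = cell x (h (lev i)) (y j)"
      using that same_lev[OF that(1)] by (simp add: key_def)
    from dist_same_cell[OF h(1) this] show ?thesis using h(2)[of "lev i"] by simp
  qed
  have same_J: "i = j" if "key i = key j" "lev i = J" for i j
    using that same_lev[OF that(1)] by (simp add: key_def)
  have same_meet: "ball (c i) (r i) \<inter> ball (c j) (r j) \<noteq> {}" if "i \<in> U" "j \<in> U" "key i = key j" for i j
  proof (cases "lev i < J")
    case True
    have "y j \<in> ball (y i) (s\<^sub>0 / 2 ^ Suc (lev i))" using same_near[OF that(3) True] by simp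
    moreover have "y j \<in> ball (y j) (s\<^sub>0 / 2 ^ Suc (lev j))" using s by simp
    ultimately show ?thesis
      using y_ball[of i] y_ball[of j] that True same_lev[OF that(3)] by fastforce
  next
    case False
    then have "i = j" using same_J[OF that(3)] lev_le[of i] by simp
    then show ?thesis using r[of i] that UW by auto
  qed
  define cls where "cls = (\<lambda>\<kappa>. {i\<in>U. key i = \<kappa>})"
  define \<omega> where "\<omega> = (\<lambda>\<kappa>. log 2 (1 + real (card (cls \<kappa>))))"
  have "\<exists>k\<in>{1..2 ^ J}. (\<Sum>\<kappa>\<in>key ` {i\<in>U. R i k}. \<omega> \<kappa>) \<le> 8 * K * (1 + ?d) * 2 ^ (J * (?d - 1))"
  proof (rule ex_light_index)
    show "finite U" "finite {1..2 ^ J :: nat}" "card {1..2 ^ J :: nat} = 2 ^ J" "?d \<ge> 2" "K \<ge> 0"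
      using finU d by (auto simp: K_def)
    show "\<omega> \<kappa> \<ge> 0" for \<kappa> by (simp add: \<omega>_def)
    show "fst (key i) \<le> J" for i using lev_le by (simp add: fst_key)
  next
    fix i assume i: "i \<in> U"
    let ?S = "{k\<in>{1..2 ^ J}. \<exists>j\<in>U. key j = key i \<and> R j k}"
    show "real (card ?S) \<le> 4 * 2 ^ (J - fst (key i))"
    proof (cases "lev i = 0")
      case True
      have "card ?S \<le> card {1..2 ^ J :: nat}" by (intro card_mono) auto
      then have "real (card ?S) \<le> real (2 ^ J)" by (simp only: of_nat_le_iff) simp
      also have "\<dots> \<le> 4 * 2 ^ (J - fst (key i))" using True by (simp add: fst_key)
      finally show ?thesis .
    next
      case False
      then have l1: "lev i \<ge> 1" by simp
      \<comment> \<open>\<open>a\<close> is the real-valued index of the sphere through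
        \<open>c i\<close>. In units of the spacing \<open>s\<^sub>0 / 2 ^ J\<close>,
        \<open>b\<close> is the maximal radius \<open>s\<^sub>0 / 2 ^ lev i\<close> plus the maximal
        offset of centres, which is half of it.\<close>
      define a where "a = (dist (c i) x / s\<^sub>0 - 1) * 2 ^ J"
      define b :: real where "b = 3 / 2 * 2 ^ (J - lev i)"
      have pw: "(2::real) ^ J = 2 ^ lev i * 2 ^ (J - lev i)"
        using lev_le[of i] by (simp add: power_add[symmetric])
      have "real (card ?S) \<le> 2 * b + 1"
      proof (rule card_nat_interval_le)
        fix k assume "k \<in> ?S"
        then obtain j where j: "j \<in> U" "key j = key i" "R j k" by auto
        have lj: "lev j = lev i" using same_lev j by blast
        have rj: "r j < s\<^sub>0 / 2 ^ lev i" using lev_small[of j] lj l1 by simp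
        have "dist (c j) (c i) \<le> s\<^sub>0 / 2 ^ Suc (lev i)"
        proof (cases "lev i < J")
          case True
          then show ?thesis using same_near[OF j(2)] lj False by (simp add: y_def)
        next
          case False
          then have "j = i" using same_J[OF j(2)] lev_le[of i] lj by simp
          then show ?thesis using s by simp
        qed
        moreover have "\<bar>dist (c i) x - dist (c j) x\<bar> \<le> dist (c j) (c i)"
          using dist_triangle[of "c i" x "c j"] dist_triangle[of "c j" x "c i"] by (simp add: dist_commute)
        ultimately have "\<bar>dist (c i) x - s\<^sub>0 * (1 + real k / 2 ^ J)\<bar> \<le> s\<^sub>0 / 2 ^ lev i + s\<^sub>0 / 2 ^ Suc (lev i)"
          using j(3) rj unfolding R_def by linarith
        also have "\<dots> = s\<^sub>0 * (b / 2 ^ J)" by (simp add: b_def pw field_simps)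
        also have "dist (c i) x - s\<^sub>0 * (1 + real k / 2 ^ J) = s\<^sub>0 * ((a - real k) / 2 ^ J)"
        proof -
          have "(a - real k) / 2 ^ J = dist (c i) x / s\<^sub>0 - 1 - real k / 2 ^ J"
            by (simp add: a_def diff_divide_distrib)
          then show ?thesis using s by (simp add: right_diff_distrib distrib_left)
        qed
        finally have "\<bar>s\<^sub>0 * ((a - real k) / 2 ^ J)\<bar> \<le> s\<^sub>0 * (b / 2 ^ J)" .
        then have "\<bar>a - real k\<bar> \<le> b" using s by (simp add: abs_mult abs_divide divide_le_cancel)
        then show "\<bar>real k - a\<bar> \<le> b" by (simp add: abs_minus_commute)
      qed (simp add: b_def)
      also have "\<dots> \<le> 4 * 2 ^ (J - lev i)" by (simp add: b_def)
      finally show ?thesis by (simp add: fst_key)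
    qed
  next
    fix l assume l: "l \<le> J"
    let ?Q = "{\<kappa>. \<kappa> \<in> key ` U \<and> fst \<kappa> = l}"
    have Q: "?Q = key ` {i\<in>U. lev i = l}" by (auto simp: fst_key)
    have finQ: "finite ?Q" using finU by simp
    have cards: "(\<Sum>\<kappa>\<in>?Q. real (card (cls \<kappa>))) \<le> card W"
    proof -
      have "(\<Sum>\<kappa>\<in>?Q. card (cls \<kappa>)) = card (\<Union>\<kappa>\<in>?Q. cls \<kappa>)"
      proof (rule card_UN_disjoint[symmetric, OF finQ])
        show "\<forall>\<kappa>\<in>?Q. finite (cls \<kappa>)" using finU by (simp add: cls_def)
        show "\<forall>\<kappa>\<in>?Q. \<forall>\<kappa>'\<in>?Q. \<kappa> \<noteq> \<kappa>' \<longrightarrow> cls \<kappa> \<inter> cls \<kappa>' = {}" unfolding cls_def by blast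
      qed
      also have "\<dots> \<le> card W" using assms(1) UW by (intro card_mono) (auto simp: cls_def)
      finally show ?thesis by (simp flip: of_nat_sum)
    qed
    show "(\<Sum>\<kappa>\<in>?Q. \<omega> \<kappa>) \<le> K * 2 ^ (l * ?d) * (1 + real (J - l) * ?d)"
    proof (cases "l < J")
      case True
      \<comment> \<open>The number of sides \<open>h l\<close> that make up the distance
        \<open>3 * s\<^sub>0\<close> within which all points \<open>y i\<close> lie.\<close>
      define q where "q = 6 * ?d * 2 ^ l"
      have "card ?Q \<le> card (cell x (h l) ` y ` {i\<in>U. lev i = l})"
      proof -
        have "?Q \<subseteq> (\<lambda>z. (l, Inl z)) ` cell x (h l) ` y ` {i\<in>U. lev i = l}"
          unfolding Q using True by (auto simp: key_def)
        moreover have "finite (cell x (h l) ` y ` {i\<in>U. lev i = l})" using finU by simp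
        ultimately show ?thesis by (rule surj_card_le[rotated])
      qed
      also have "\<dots> \<le> (2 * q + 1) ^ ?d"
      proof (rule card_cells_le(2)[OF h(1)])
        fix p assume "p \<in> y ` {i\<in>U. lev i = l}"
        moreover have "real q * h l = 3 * s\<^sub>0" using d0 by (simp add: q_def h_def)
        ultimately show "dist p x \<le> real q * h l" using y_dist by auto
      qed
      finally have "real (card ?Q) \<le> real ((2 * q + 1) ^ ?d)" by (simp only: of_nat_le_iff)
      also have "\<dots> \<le> (13 * real ?d * 2 ^ l) ^ ?d"
      proof -
        have "1 * 1 \<le> real ?d * 2 ^ l" using d by (intro mult_mono) auto
        then have "real (2 * q + 1) \<le> 13 * real ?d * 2 ^ l" by (simp add: q_def)
        then show ?thesis by (simp only: of_nat_power) (intro power_mono, auto)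
      qed
      also have "\<dots> = (13 * real ?d) ^ ?d * 2 ^ (l * ?d)" by (simp add: power_mult_distrib power_mult)
      finally have M: "real (card ?Q) \<le> (13 * real ?d) ^ ?d * 2 ^ (l * ?d)" .
      \<comment> \<open>The threshold exponent is \<open>(J - l) * ?d\<close>: spreading at most
        \<open>2 ^ (J * ?d)\<close> balls over about \<open>2 ^ (l * ?d)\<close> cells gives this
        average size.\<close>
      have "(\<Sum>\<kappa>\<in>?Q. \<omega> \<kappa>) \<le> (\<Sum>\<kappa>\<in>?Q. 1 + real ((J - l) * ?d) + 2 * real (card (cls \<kappa>)) / 2 ^ ((J - l) * ?d))"
        unfolding \<omega>_def by (intro sum_mono log_le_threshold)
      also have "\<dots> = card ?Q * (1 + real ((J - l) * ?d)) + 2 / 2 ^ ((J - l) * ?d) * (\<Sum>\<kappa>\<in>?Q. real (card (cls \<kappa>)))"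
        by (simp add: sum.distrib sum_distrib_left)
      also have "\<dots> \<le> (13 * real ?d) ^ ?d * 2 ^ (l * ?d) * (1 + real ((J - l) * ?d)) + 2 / 2 ^ ((J - l) * ?d) * 2 ^ (J * ?d)"
        using M order_trans[OF cards card] by (intro add_mono mult_right_mono mult_left_mono) auto
      also have "2 / 2 ^ ((J - l) * ?d) * 2 ^ (J * ?d) = (2::real) * 2 ^ (l * ?d)"
      proof -
        have "J * ?d = l * ?d + (J - l) * ?d" using l by (simp add: add_mult_distrib[symmetric])
        then show ?thesis by (simp add: power_add)
      qed
      also have "(2::real) * 2 ^ (l * ?d) \<le> 2 * 2 ^ (l * ?d) * (1 + real ((J - l) * ?d))" by simp
      finally show ?thesis by (simp only: K_def of_nat_mult distrib_right)
    next
      case False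
      then have lJ: "l = J" using l by simp
      \<comment> \<open>At level \<open>J\<close> the classes are singletons of weight
        \<open>log 2 2\<close>, so the total is at most the number of balls.\<close>
      have "\<omega> \<kappa> = 1" if \<kappa>: "\<kappa> \<in> ?Q" for \<kappa>
      proof -
        obtain i where i: "i \<in> U" "\<kappa> = key i" "lev i = J" using \<kappa> lJ by (auto simp: fst_key)
        have "j = i" if "key j = key i" for j using same_J[OF that[symmetric] i(3)] by (rule sym)
        then have "cls \<kappa> = {i}" using i by (auto simp: cls_def)
        then show ?thesis by (simp add: \<omega>_def)
      qed
      then have "(\<Sum>\<kappa>\<in>?Q. \<omega> \<kappa>) = card ?Q" by simp
      also have "\<dots> \<le> card W"
      proof -
        have "card ?Q \<le> card (key ` U)" using finU by (intro card_mono) auto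
        also have "\<dots> \<le> card U" using finU by (rule card_image_le)
        also have "\<dots> \<le> card W" using assms(1) UW by (rule card_mono)
        finally show ?thesis by simp
      qed
      also have "\<dots> \<le> 1 * 2 ^ (J * ?d)" using card by simp
      also have "\<dots> \<le> K * 2 ^ (J * ?d)" by (intro mult_right_mono) (auto simp: K_def)
      finally show ?thesis by (simp add: lJ)
    qed
  qed
  then obtain k where k: "k \<in> {1..2 ^ J}" "(\<Sum>\<kappa>\<in>key ` {i\<in>U. R i k}. \<omega> \<kappa>) \<le> 8 * K * (1 + ?d) * 2 ^ (J * (?d - 1))" by blast
  let ?T = "key ` {i\<in>U. R i k}"
  have "inj_on cls ?T" by (auto simp: inj_on_def cls_def)
  then have "(\<Sum>C\<in>cls ` ?T. log 2 (1 + real (card C))) = (\<Sum>\<kappa>\<in>?T. \<omega> \<kappa>)"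
    by (simp add: sum.reindex \<omega>_def)
  moreover have "finite (cls ` ?T)" using finU by simp
  moreover have "C \<noteq> {} \<and> C \<subseteq> W \<and> (\<forall>i\<in>C. \<forall>j\<in>C. ball (c i) (r i) \<inter> ball (c j) (r j) \<noteq> {})"
    if "C \<in> cls ` ?T" for C
  proof -
    obtain i where i: "i \<in> U" "C = cls (key i)" using \<open>C \<in> cls ` ?T\<close> by blast
    have "i \<in> C" using i by (simp add: cls_def)
    moreover have "C \<subseteq> W" using i UW by (auto simp: cls_def)
    moreover have "ball (c a) (r a) \<inter> ball (c b) (r b) \<noteq> {}" if "a \<in> C" "b \<in> C" for a b
      using same_meet[of a b] that i by (simp add: cls_def)
    ultimately show ?thesis by blast
  qed
  moreover have "{i\<in>W. \<bar>dist (c i) x - s\<^sub>0 * (1 + real k / 2 ^ J)\<bar> \<le> r i} \<subseteq> \<Union>(cls ` ?T)"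
  proof
    fix i assume "i \<in> {i\<in>W. \<bar>dist (c i) x - s\<^sub>0 * (1 + real k / 2 ^ J)\<bar> \<le> r i}"
    then have "i \<in> {i\<in>U. R i k}" using k(1) by (auto simp: U_def R_def)
    then show "i \<in> \<Union>(cls ` ?T)" by (auto simp: cls_def)
  qed
  ultimately show ?thesis using k by (intro bexI[of _ k] exI[of _ "cls ` ?T"]) auto
qed

text \<open>Here \<open>N\<close> bounds the number of balls of radius \<open>s\<close> needed to cover a ball of radius \<open>2 s\<close>.\<close>

lemma ball_family_separator:
  fixes c :: "'v \<Rightarrow> real ^ 'd"
  assumes "finite W" "W \<noteq> {}" and r: "\<And>i. i \<in> W \<Longrightarrow> r i > 0" and d: "CARD('d) \<ge> 2"
  defines "N \<equiv> (4 * CARD('d) + 1) ^ CARD('d)"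
    and "K \<equiv> 8 * ((13 * real CARD('d)) ^ CARD('d) + 2) * (1 + CARD('d)) * 2 ^ CARD('d)"
  shows "\<exists>F A B. finite F \<and> (\<forall>C\<in>F. C \<noteq> {} \<and> C \<subseteq> W \<and>
       (\<forall>i\<in>C. \<forall>j\<in>C. ball (c i) (r i) \<inter> ball (c j) (r j) \<noteq> {})) \<and>
     W = \<Union>F \<union> (A \<union> B) \<and> \<Union>F \<inter> (A \<union> B) = {} \<and> A \<inter> B = {} \<and>
     (\<forall>a\<in>A. \<forall>b\<in>B. cball (c a) (r a) \<inter> cball (c b) (r b) = {}) \<and>
     card A \<le> (1 - 1 / (2 * real N)) * card W \<and> card B \<le> (1 - 1 / (2 * real N)) * card W \<and>
     (\<Sum>C\<in>F. log 2 (1 + real (card C))) \<le> K * card W powr (1 - 1 / CARD('d))"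
proof -
  let ?d = "CARD('d)" and ?n = "card W"
  have n1: "?n \<ge> 1" using assms(1,2) by (simp add: Suc_leI card_gt_0_iff)
  have N1: "real N \<ge> 1" by (simp add: N_def)
  \<comment> \<open>The ceiling serves both sides: an inner ball with \<open>m\<close> centres
    leaves at most the fraction \<open>1 - 1 / (2 * N)\<close> outside, while
    \<open>m - 1 < ?n / (2 * N)\<close> keeps \<open>N\<close> sparse cells within half of all
    balls.\<close>
  define m where "m = nat \<lceil>real ?n / (2 * real N)\<rceil>"
  have npos: "real ?n / (2 * real N) > 0" using n1 N1 by simp
  then have m: "real m \<ge> real ?n / (2 * real N)" "real m < real ?n / (2 * real N) + 1" "m \<ge> 1"
    unfolding m_def by linarith+
  have "real ?n / (2 * real N) \<le> real ?n / 1" using N1 by (intro divide_left_mono) auto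
  then have "m \<le> ?n" unfolding m_def by (simp add: nat_le_iff ceiling_le_iff)
  then obtain i\<^sub>0 s where i0: "i\<^sub>0 \<in> W" "s \<ge> 0" "m \<le> card {k\<in>W. dist (c i\<^sub>0) (c k) \<le> s}"
    and sparse: "\<And>j. j \<in> W \<Longrightarrow> card {k\<in>W. dist (c j) (c k) < s} < m"
    using ex_densest_ball[OF assms(1) m(3), of c] by blast
  define x where "x = c i\<^sub>0"
  have far: "real (card Y) \<le> (1 - 1 / (2 * real N)) * ?n" if "Y \<subseteq> W" "\<And>k. k \<in> Y \<Longrightarrow> dist x (c k) > s" for Y
  proof -
    let ?X = "{k\<in>W. dist (c i\<^sub>0) (c k) \<le> s}"
    have "card Y + card ?X = card (Y \<union> ?X)"
      using that assms(1) by (intro card_Un_disjoint[symmetric]) (auto simp: x_def not_le[symmetric] intro: finite_subset)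
    also have "\<dots> \<le> ?n" using that assms(1) by (intro card_mono) auto
    finally have "real (card Y) \<le> real ?n - real ?n / (2 * real N)" using i0(3) m(1) by linarith
    then show ?thesis by (simp add: left_diff_distrib)
  qed
  \<comment> \<open>If \<open>s = 0\<close>, at least \<open>m\<close> balls are concentric, and this clique alone is a separator.\<close>
  show ?thesis
  proof (cases "s = 0")
    case True
    define C where "C = {k\<in>W. c k = x}"
    have Cn: "C \<noteq> {}" "finite C" "C \<subseteq> W" using i0 assms(1) by (auto simp: C_def x_def)
    have "ball (c i) (r i) \<inter> ball (c j) (r j) \<noteq> {}" if "i \<in> C" "j \<in> C" for i j
    proof -
      have "x \<in> ball (c i) (r i) \<inter> ball (c j) (r j)" using that r by (auto simp: C_def)
      then show ?thesis by blast
    qed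
    moreover have "real (card (W - C)) \<le> (1 - 1 / (2 * real N)) * ?n"
      using True by (intro far) (auto simp: C_def)
    \<comment> \<open>One clique costs at most \<open>4 * sqrt ?n\<close>, and
      \<open>sqrt ?n \<le> ?n powr (1 - 1 / ?d)\<close> because the dimension is at least 2.\<close>
    moreover have "log 2 (1 + real (card C)) \<le> K * ?n powr (1 - 1 / ?d)"
    proof -
      define y where "y = sqrt (real ?n)"
      have y: "y \<ge> 1" "real ?n = y\<^sup>2" using n1 by (auto simp: y_def)
      have "card C \<le> ?n" using assms(1) Cn by (intro card_mono) auto
      then have "1 + real (card C) \<le> 1 + y\<^sup>2" using y by simp
      also have "\<dots> \<le> (1 + y)\<^sup>2" using y by (simp add: power2_eq_square algebra_simps)
      also have "\<dots> \<le> (exp y)\<^sup>2" using y exp_ge_add_one_self[of y] by (intro power_mono) auto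
      also have "\<dots> = exp (2 * y)" by (simp add: exp_double)
      finally have "ln (1 + real (card C)) \<le> ln (exp (2 * y))" by (intro ln_mono) auto
      then have "ln (1 + real (card C)) \<le> 2 * y" by simp
      also have "\<dots> \<le> 4 * y * ln 2" using ln2_ge_two_thirds y mult_left_mono[of "1/2" "ln 2" "4 * y"] by simp
      finally have "log 2 (1 + real (card C)) \<le> 4 * y" by (simp add: log_def pos_divide_le_eq)
      also have "\<dots> \<le> K * ?n powr (1 - 1 / ?d)"
      proof (intro mult_mono)
        have "(8::real) * 2 * 1 * 1 \<le> 8 * ((13 * real ?d) ^ ?d + 2) * (1 + real ?d) * 2 ^ ?d"
          by (intro mult_mono) auto
        then show "4 \<le> K" by (simp add: K_def)
        have "1 / real ?d \<le> 1 / 2" using d by (intro divide_left_mono) auto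
        then have "real ?n powr (1/2) \<le> ?n powr (1 - 1 / ?d)" using n1 by (intro powr_mono) auto
        then show "y \<le> ?n powr (1 - 1 / ?d)" by (simp add: y_def powr_half_sqrt)
        show "0 \<le> K" by (simp add: K_def)
      qed (use y in auto)
      finally show ?thesis .
    qed
    moreover have "0 \<le> (1 - 1 / (2 * real N)) * ?n" using N1 by simp
    ultimately show ?thesis
      using Cn by (intro exI[of _ "{C}"] exI[of _ "W - C"] exI[of _ "{}"]) auto
  next
    case False
    then have s: "s > 0" using i0 by simp
    obtain J where J: "J \<ge> 1" "real ?n \<le> 2 ^ (J * ?d)" "2 ^ J \<le> 2 * real ?n powr (1 / ?d)"
      using dyadic_exponent[OF n1, of ?d] d by auto
    let ?s = "\<lambda>k. s * (1 + real k / 2 ^ J)"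
    obtain k F where k: "k \<in> {1..2 ^ J}" and F: "finite F" "\<forall>C\<in>F. C \<noteq> {} \<and> C \<subseteq> W \<and>
       (\<forall>i\<in>C. \<forall>j\<in>C. ball (c i) (r i) \<inter> ball (c j) (r j) \<noteq> {})"
      "{i\<in>W. \<bar>dist (c i) x - ?s k\<bar> \<le> r i} \<subseteq> \<Union>F"
      "(\<Sum>C\<in>F. log 2 (1 + real (card C))) \<le> 8 * ((13 * real ?d) ^ ?d + 2) * (1 + ?d) * 2 ^ (J * (?d - 1))"
      using light_sphere[where x = x and c = c and r = r, OF assms(1) r d s J(1,2)] by blast
    have sk: "s < ?s k" "?s k \<le> 2 * s"
    proof -
      have k1: "real k \<ge> 1" "real k \<le> 2 ^ J"
        using k of_nat_le_iff[of k "2 ^ J", where 'a = real] by simp_all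
      then have "0 < real k / 2 ^ J" "real k / 2 ^ J \<le> 1" by simp_all
      then have "s * 1 < ?s k" "?s k \<le> s * 2"
        using s by (intro mult_strict_left_mono mult_left_mono; simp)+
      then show "s < ?s k" "?s k \<le> 2 * s" by (simp_all only: mult_1_right mult.commute[of s 2])
    qed
    \<comment> \<open>Inside and outside of the chosen sphere. The inequalities are strict, so even
      the closed balls of the two sides are disjoint.\<close>
    define A where "A = {i\<in>W - \<Union>F. dist (c i) x + r i < ?s k}"
    define B where "B = {i\<in>W - \<Union>F. ?s k < dist (c i) x - r i}"
    have cover: "W - \<Union>F \<subseteq> A \<union> B"
    proof
      fix i assume i: "i \<in> W - \<Union>F"
      then have "r i < \<bar>dist (c i) x - ?s k\<bar>" using F(3) by (auto simp: not_le[symmetric])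
      then have "dist (c i) x + r i < ?s k \<or> ?s k < dist (c i) x - r i" by linarith
      then show "i \<in> A \<union> B" using i unfolding A_def B_def by blast
    qed
    have AB: "A \<inter> B = {}"
    proof -
      have False if "i \<in> A" "i \<in> B" for i using that r[of i] by (simp add: A_def B_def)
      then show ?thesis by blast
    qed
    have sep: "cball (c a) (r a) \<inter> cball (c b) (r b) = {}" if "a \<in> A" "b \<in> B" for a b
    proof -
      have False if "p \<in> cball (c a) (r a)" "p \<in> cball (c b) (r b)" for p
      proof -
        have "dist p x \<le> dist (c a) p + dist (c a) x" by (metis dist_commute dist_triangle)
        moreover have "dist (c b) x \<le> dist (c b) p + dist p x" by (rule dist_triangle)
        ultimately show False using that \<open>a \<in> A\<close> \<open>b \<in> B\<close> by (simp add: A_def B_def)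
      qed
      then show ?thesis by blast
    qed
    \<comment> \<open>The centres in \<open>A\<close> lie within \<open>2 * s\<close> of
      \<open>x\<close>, hence in at most \<open>N\<close> cells, each with at most
      \<open>m - 1\<close> centres.\<close>
    have cA: "real (card A) \<le> (1 - 1 / (2 * real N)) * ?n"
    proof -
      have "dist (c i) x \<le> 2 * s" if "i \<in> A" for i
      proof -
        have "dist (c i) x + r i < ?s k" "0 < r i" using that r by (auto simp: A_def)
        then show ?thesis using sk(2) by linarith
      qed
      then have "A \<subseteq> {k\<in>W. dist (c k) x \<le> 2 * s}" by (auto simp: A_def)
      then have "card A \<le> card {k\<in>W. dist (c k) x \<le> 2 * s}"
        using assms(1) by (intro card_mono) auto
      also have "\<dots> \<le> N * (m - 1)"
        unfolding N_def
      proof (intro doubling_count assms(1) s)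
        fix j assume "j \<in> W"
        then show "card {k\<in>W. dist (c j) (c k) < s} \<le> m - 1" using sparse[of j] by linarith
      qed
      finally have "real (card A) \<le> real (N * (m - 1))" by (simp only: of_nat_le_iff)
      then have "real (card A) \<le> real N * (real m - 1)" using m(3) by (simp add: of_nat_diff)
      also have "\<dots> \<le> real N * (real ?n / (2 * real N))" using m(2) N1 by (intro mult_left_mono) auto
      also have "\<dots> = (1 - 1 / 2) * ?n" using N1 by simp
      also have "\<dots> \<le> (1 - 1 / (2 * real N)) * ?n"
        using N1 by (intro mult_right_mono diff_left_mono divide_left_mono) auto
      finally show ?thesis .
    qed
    have cB: "real (card B) \<le> (1 - 1 / (2 * real N)) * ?n"
    proof (rule far)
      fix i assume "i \<in> B"
      then show "dist x (c i) > s" using sk(1) r[of i] by (auto simp: B_def dist_commute)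
    qed (auto simp: B_def)
    have wt: "(\<Sum>C\<in>F. log 2 (1 + real (card C))) \<le> K * ?n powr (1 - 1 / ?d)"
    proof -
      \<comment> \<open>Replacing the number of spheres \<open>2 ^ J\<close> by
        \<open>2 * ?n powr (1 / ?d)\<close> is the source of the factor \<open>2 ^ CARD('d)\<close>
        in \<open>K\<close>.\<close>
      have "(2::real) ^ (J * (?d - 1)) = (2 ^ J) ^ (?d - 1)" by (simp add: power_mult)
      also have "\<dots> \<le> (2 * real ?n powr (1 / ?d)) ^ (?d - 1)" using J(3) by (intro power_mono) auto
      also have "\<dots> = 2 ^ (?d - 1) * real ?n powr (1 / ?d * real (?d - 1))"
        using n1 by (simp add: power_mult_distrib powr_powr flip: powr_realpow)
      also have "\<dots> \<le> 2 ^ ?d * real ?n powr (1 - 1 / ?d)"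
      proof (intro mult_mono)
        have "1 / real ?d * real (?d - 1) = 1 - 1 / ?d" using d by (simp add: of_nat_diff diff_divide_distrib)
        then show "real ?n powr (1 / ?d * real (?d - 1)) \<le> real ?n powr (1 - 1 / ?d)" by simp
      qed (auto intro: power_increasing)
      finally have "8 * ((13 * real ?d) ^ ?d + 2) * (1 + ?d) * 2 ^ (J * (?d - 1))
          \<le> 8 * ((13 * real ?d) ^ ?d + 2) * (1 + ?d) * (2 ^ ?d * real ?n powr (1 - 1 / ?d))"
        by (intro mult_left_mono) auto
      then show ?thesis using F(4) by (simp add: K_def mult.assoc)
    qed
    have "W = \<Union>F \<union> (A \<union> B)" using cover F(2) by (auto simp: A_def B_def)
    moreover have "\<Union>F \<inter> (A \<union> B) = {}" by (auto simp: A_def B_def)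
    ultimately show ?thesis
      using F(1,2) AB sep cA cB wt by (intro exI[of _ F] exI[of _ A] exI[of _ B]) simp
  qed
qed

section \<open>Assembly for intersection graphs of balls\<close>

text \<open>Without vertices there is none to pick for an update, but the only state is already
  stationary at time 0.\<close>

lemma mixing_time_empty_graph:
  assumes "lam > 0"
  shows "mixing_time ({}, E) lam \<le> enat 0"
proof (rule mixing_time_le)
  have \<Omega>: "indep_sets_of ({}, E) = {{}}" by (auto simp: indep_iff)
  then show "indep_sets_of ({}, E) \<noteq> {}" "finite (indep_sets_of ({}, E))" by simp_all
  show "tv_dist (indep_sets_of ({}, E)) (pmf (glauber_dist ({}, E) lam I 0)) (hardcore ({}, E) lam) \<le> 1 / 4"
    if "I \<in> indep_sets_of ({}, E)" for I
    using that unfolding \<Omega>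
    by (simp add: \<Omega> tv_dist_def glauber_dist_def hardcore_def hardcore_Z_def)
qed

theorem theorem2:
  assumes "CARD('d::finite) \<ge> 2"
  shows "\<exists>C::real. C > 0 \<and>
    (\<forall>(n::nat) (B :: nat \<Rightarrow> (real ^ 'd) set) (lam::real).
       (\<forall>i<n. is_ball (B i)) \<longrightarrow> lam > 0 \<longrightarrow>
       ereal_of_enat (mixing_time (intersection_graph {..<n} B) lam)
         \<le> ereal ((2 * exp \<bar>ln lam\<bar>) powr (C * real n powr (1 - 1 / real CARD('d)))))"
proof -
  let ?d = "CARD('d)"
  define \<gamma> where "\<gamma> = 1 - 1 / real ?d"
  define N where "N = (4 * ?d + 1) ^ ?d"
  define K where "K = 8 * ((13 * real ?d) ^ ?d + 2) * (1 + ?d) * 2 ^ ?d"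
  define \<alpha> where "\<alpha> = 1 - 1 / (2 * real N)"
  \<comment> \<open>The fixed point of the exponent recursion with separator cost \<open>K\<close>;
    passing to the mixing time adds 12.\<close>
  define C where "C = (2 * K + 8) / (1 - \<alpha> powr \<gamma>)"
  have "1 / real ?d \<le> 1 / 2" using assms by (intro divide_left_mono) auto
  then have \<gamma>: "\<gamma> \<ge> 1 / 2" by (simp add: \<gamma>_def)
  have "real N \<ge> 1" by (simp add: N_def)
  then have \<alpha>: "0 < \<alpha>" "\<alpha> < 1" by (simp_all add: \<alpha>_def)
  have K: "K \<ge> 0" by (simp add: K_def)
  have "\<alpha> powr \<gamma> < 1" using powr_less_mono2[of \<gamma> \<alpha> 1] \<alpha> \<gamma> by simp
  then have C: "C \<ge> 0" using K by (simp add: C_def)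
  have "ereal_of_enat (mixing_time (intersection_graph {..<n} B) lam)
      \<le> ereal ((2 * exp \<bar>ln lam\<bar>) powr ((C + 12) * real n powr \<gamma>))"
    if balls: "\<forall>i<n. is_ball (B i)" and lam: "lam > 0"
    for n :: nat and B :: "nat \<Rightarrow> (real ^ 'd) set" and lam :: real
  proof -
    define E where "E = {{u, v} | u v. u \<in> {..<n} \<and> v \<in> {..<n} \<and> u \<noteq> v \<and> B u \<inter> B v \<noteq> {}}"
    have G: "intersection_graph {..<n} B = ({..<n}, E)" by (simp add: intersection_graph_def E_def)
    have E: "{u, v} \<in> E \<longleftrightarrow> u < n \<and> v < n \<and> u \<noteq> v \<and> B u \<inter> B v \<noteq> {}" for u v
      by (auto simp: E_def doubleton_eq_iff)
    show ?thesis
    proof (cases "n = 0")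
      case True
      have "ereal_of_enat (mixing_time (intersection_graph {..<n} B) lam) \<le> ereal_of_enat (enat 0)"
        using mixing_time_empty_graph[OF lam, of E] True unfolding ereal_of_enat_le_iff G by simp
      also have "\<dots> \<le> ereal ((2 * exp \<bar>ln lam\<bar>) powr ((C + 12) * real n powr \<gamma>))" by simp
      finally show ?thesis .
    next
      case False
      \<comment> \<open>Open and closed balls are treated together by this sandwich: cliques are
        certified by intersecting open balls, non-edges by disjoint closed balls.\<close>
      have "\<exists>p \<rho>. 0 < \<rho> \<and> ball p \<rho> \<subseteq> B i \<and> B i \<subseteq> cball p \<rho>" if "i < n" for i
      proof -
        obtain p \<rho> where \<rho>: "0 < \<rho>" "B i = ball p \<rho> \<or> B i = cball p \<rho>"
          using balls \<open>i < n\<close> unfolding is_ball_def by blast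
        from \<rho>(2) have "ball p \<rho> \<subseteq> B i \<and> B i \<subseteq> cball p \<rho>"
          using ball_subset_cball[of p \<rho>] by (elim disjE) simp_all
        then show ?thesis using \<rho>(1) by blast
      qed
      then obtain p \<rho> where B: "\<And>i. i < n \<Longrightarrow> 0 < \<rho> i \<and> ball (p i) (\<rho> i) \<subseteq> B i \<and> B i \<subseteq> cball (p i) (\<rho> i)"
        by metis
      have "poincare E lam {..<n} ((2 * exp \<bar>ln lam\<bar>) powr (C * card {..<n} powr \<gamma>))"
        unfolding C_def
      proof (rule poincare_recursion[where V = "{..<n}"])
        show "2 \<le> 2 * exp \<bar>ln lam\<bar>" by simp
        fix W assume W: "W \<subseteq> {..<n}" "W \<noteq> {}"
        then have finW: "finite W" and W\<rho>: "\<And>i. i \<in> W \<Longrightarrow> 0 < \<rho> i"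
          using B by (auto intro: finite_subset)
        obtain F A A' where F: "finite F" "\<forall>C\<in>F. C \<noteq> {} \<and> C \<subseteq> W \<and>
             (\<forall>i\<in>C. \<forall>j\<in>C. ball (p i) (\<rho> i) \<inter> ball (p j) (\<rho> j) \<noteq> {})"
          "W = \<Union>F \<union> (A \<union> A')" "\<Union>F \<inter> (A \<union> A') = {}" "A \<inter> A' = {}"
          "\<forall>a\<in>A. \<forall>b\<in>A'. cball (p a) (\<rho> a) \<inter> cball (p b) (\<rho> b) = {}"
          "card A \<le> \<alpha> * card W" "card A' \<le> \<alpha> * card W"
          "(\<Sum>C\<in>F. log 2 (1 + real (card C))) \<le> K * card W powr \<gamma>"
          using ball_family_separator[where c = p and r = \<rho>, OF finW W(2) W\<rho> assms, folded N_def K_def \<alpha>_def \<gamma>_def] by blast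
        have "hardcore_Z (\<Union>F, E) lam \<le> (2 * exp \<bar>ln lam\<bar>) powr (\<Sum>C\<in>F. log 2 (1 + real (card C)))"
        proof (rule clique_union_Z_le[OF lam F(1)])
          show "finite C \<and> C \<noteq> {}" if "C \<in> F" for C
          proof -
            have "C \<noteq> {}" "C \<subseteq> W" using F(2) that by blast+
            then show ?thesis using finite_subset[OF _ finW] by blast
          qed
          show "{u, v} \<in> E" if "C \<in> F" "u \<in> C" "v \<in> C" "u \<noteq> v" for C u v
          proof -
            have uv: "u < n" "v < n" using F(2) W(1) that by blast+
            have "ball (p u) (\<rho> u) \<inter> ball (p v) (\<rho> v) \<noteq> {}" using F(2) that by blast
            then have "B u \<inter> B v \<noteq> {}" using B[OF uv(1)] B[OF uv(2)] by blast
            then show ?thesis using E uv that(4) by blast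
          qed
        qed
        also have "\<dots> \<le> (2 * exp \<bar>ln lam\<bar>) powr (K * card W powr \<gamma>)"
        proof (rule powr_mono[OF F(9)])
          have "1 \<le> exp \<bar>ln lam\<bar>" by simp
          then show "1 \<le> 2 * exp \<bar>ln lam\<bar>" by linarith
        qed
        finally have Z: "hardcore_Z (\<Union>F, E) lam \<le> (2 * exp \<bar>ln lam\<bar>) powr (K * card W powr \<gamma>)" .
        have "\<forall>a\<in>A. \<forall>b\<in>A'. {a, b} \<notin> E"
        proof (intro ballI)
          fix a b assume ab: "a \<in> A" "b \<in> A'"
          then have n: "a < n" "b < n" using F(3) W(1) by blast+
          have "cball (p a) (\<rho> a) \<inter> cball (p b) (\<rho> b) = {}" using F(6) ab by blast
          then have "B a \<inter> B b = {}" using B[OF n(1)] B[OF n(2)] by blast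
          then show "{a, b} \<notin> E" using E by blast
        qed
        then show "\<exists>S A B. W = S \<union> (A \<union> B) \<and> S \<inter> (A \<union> B) = {} \<and> A \<inter> B = {} \<and>
            (\<forall>a\<in>A. \<forall>b\<in>B. {a, b} \<notin> E) \<and> card A \<le> \<alpha> * card W \<and> card B \<le> \<alpha> * card W \<and>
            hardcore_Z (S, E) lam \<le> (2 * exp \<bar>ln lam\<bar>) powr (K * card W powr \<gamma>)"
          using F(3-5,7,8) Z by blast
      qed (use lam \<gamma> \<alpha> K in auto)
      then have "ereal_of_enat (mixing_time ({..<n}, E) lam)
          \<le> ereal ((2 * exp \<bar>ln lam\<bar>) powr ((C + 12) * card {..<n} powr \<gamma>))"
        using False by (intro mixing_time_poincare lam \<gamma> C) auto
      then show ?thesis by (simp only: G card_lessThan)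
    qed
  qed
  then show ?thesis
    using C unfolding \<gamma>_def by (intro exI[of _ "C + 12"]) auto
qed

end
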